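(* (1) The union $A\cup B$ of the simplices $$A=\Big\{\varphi:\ \tfrac\pi2\ge\varphi_1\ge\varphi_2\ge\varphi_3\ge0\Big\},\qquad B=\Big\{\varphi:\ \varphi_3+\tfrac\pi2\ge\varphi_1\ge\tfrac\pi2\ge\varphi_2\ge\varphi_3\Big\}$$ gives a fundamental domain for the action of $W$ on $\mathbb R^3/\Gamma_\varphi=(\mathbb R/\pi\mathbb Z)^3$. (2) The real moduli space $\mathcal M$ is obtained by gluing the face $(P'QZ)$ to the face $(ZPP')$ by the transformation $\gamma\in\Gamma_\varphi\rtimes W$, $$\gamma(\varphi_1,\varphi_2,\varphi_3)=(\pi-\varphi_1+\varphi_2,\ \pi-\varphi_1+\varphi_3,\ \pi-\varphi_1),$$ and crossing each wall, i.e. each face whose supporting hyperplane contains $0$, by the corresponding reflection (in $W$).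
   Context: $\Gamma_\varphi=(\pi\mathbb Z)^3\subset\mathbb R^3$. $W\simeq S_4$ is the group of transformations of $\mathbb R^3$ (and of $(\mathbb R/\pi\mathbb Z)^3$) generated by the permutations of $(\varphi_1,\varphi_2,\varphi_3)$ and by $(\varphi_1,\varphi_2,\varphi_3)\mapsto(-\varphi_1,\varphi_2-\varphi_1,\varphi_3-\varphi_1)$. $P=(\frac\pi2,\frac\pi2,\frac\pi2)$, $P'=(\frac\pi2,\frac\pi2,0)$, $Q=(\frac\pi2,0,0)$, $Z=P+Q=(\pi,\frac\pi2,\frac\pi2)$; $(XYT)$ denotes the triangular face with vertices $X,Y,T$. The real moduli space of noncommutative $3$-spheres is $\mathcal M=(U(1)\times SO(4))\backslash\mathcal S$, where $\mathcal S$ is the space of symmetric unitary $4\times4$ matrices, with $\lambda\in U(1)$ acting by $\Lambda\mapsto\lambda^2\Lambda$ and $V\in SO(4)$ by $\Lambda\mapsto V\Lambda V^t$; it is the quotient $W\backslash(\mathbb R/\pi\mathbb Z)^3$ through $\varphi\mapsto\mathrm{diag}(1,e^{-2i\varphi_1},e^{-2i\varphi_2},e^{-2i\varphi_3})$. *)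

theory Defs
  imports "HOL-Analysis.Analysis" "HOL-Algebra.Bij" "HOL-Algebra.Generated_Groups"
begin

section \<open>Quotient spaces and fundamental domains\<close>

definition quotient_topology :: "'a topology \<Rightarrow> ('a \<times> 'a) set \<Rightarrow> 'a set topology" where
  "quotient_topology X R = topology (\<lambda>U. U \<subseteq> topspace X // R \<and>
     openin X {x \<in> topspace X. R `` {x} \<in> U})"

lemma openin_quotient_topology:
  "openin (quotient_topology X R) U \<longleftrightarrow>
     U \<subseteq> topspace X // R \<and> openin X {x \<in> topspace X. R `` {x} \<in> U}"
proof -
  have "istopology (\<lambda>U. U \<subseteq> topspace X // R \<and> openin X {x \<in> topspace X. R `` {x} \<in> U})"
    unfolding istopology_def
  proof (intro conjI allI impI)
    fix S T
    assume S: "S \<subseteq> topspace X // R \<and> openin X {x \<in> topspace X. R `` {x} \<in> S}"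
      and T: "T \<subseteq> topspace X // R \<and> openin X {x \<in> topspace X. R `` {x} \<in> T}"
    show "S \<inter> T \<subseteq> topspace X // R" using S by blast
    have "{x \<in> topspace X. R `` {x} \<in> S \<inter> T} =
        {x \<in> topspace X. R `` {x} \<in> S} \<inter> {x \<in> topspace X. R `` {x} \<in> T}" by blast
    then show "openin X {x \<in> topspace X. R `` {x} \<in> S \<inter> T}" using S T by (simp add: openin_Int)
  next
    fix K
    assume K: "\<forall>S\<in>K. S \<subseteq> topspace X // R \<and> openin X {x \<in> topspace X. R `` {x} \<in> S}"
    show "\<Union>K \<subseteq> topspace X // R" using K by blast
    have "{x \<in> topspace X. R `` {x} \<in> \<Union>K} = (\<Union>S\<in>K. {x \<in> topspace X. R `` {x} \<in> S})" by blast
    then show "openin X {x \<in> topspace X. R `` {x} \<in> \<Union>K}" using K by auto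
  qed
  then show ?thesis
    by (simp add: quotient_topology_def topology_inverse')
qed

lemma topspace_quotient_topology: "topspace (quotient_topology X R) = topspace X // R"
proof -
  have "{x \<in> topspace X. R `` {x} \<in> topspace X // R} = topspace X"
    by (auto simp: quotient_def)
  then have "openin (quotient_topology X R) (topspace X // R)"
    by (simp add: openin_quotient_topology)
  then show ?thesis
    by (meson openin_quotient_topology openin_subset openin_topspace subset_antisym)
qed

definition fundamental_domain ::
    "'a topology \<Rightarrow> 'g set \<Rightarrow> ('g \<Rightarrow> 'a \<Rightarrow> 'a) \<Rightarrow> 'a set \<Rightarrow> bool" where
  "fundamental_domain X G act F \<longleftrightarrow>
     F \<subseteq> topspace X \<and>
     X closure_of (X interior_of F) = F \<and>
     (\<Union>g\<in>G. act g ` F) = topspace X \<and>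
     (\<forall>g\<in>G. \<forall>h\<in>G. g \<noteq> h \<longrightarrow>
        act g ` (X interior_of F) \<inter> act h ` (X interior_of F) = {})"


section \<open>The torus and the groups acting on it\<close>

definition Gamma :: "(real^3) set" where
  "Gamma = {x. \<forall>i. \<exists>k::int. x $ i = pi * of_int k}"

definition torus_rel :: "((real^3) \<times> (real^3)) set" where
  "torus_rel = {(x, y). y - x \<in> Gamma}"

definition torus :: "(real^3) set topology" where
  "torus = quotient_topology euclidean torus_rel"

definition torus_proj :: "real^3 \<Rightarrow> (real^3) set" where
  "torus_proj x = torus_rel `` {x}"

definition perm_action :: "(3 \<Rightarrow> 3) \<Rightarrow> real^3 \<Rightarrow> real^3" where
  "perm_action \<sigma> x = (\<chi> i. x $ \<sigma> i)"

definition shift_gen :: "real^3 \<Rightarrow> real^3" where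
  "shift_gen x = vector [- x $ 1, x $ 2 - x $ 1, x $ 3 - x $ 1]"

text \<open>Elements of \<open>W\<close> preserve \<open>Gamma\<close>, hence act on the points of the torus, which are
  cosets of \<open>Gamma\<close>, by taking images of sets.\<close>

definition W :: "(real^3 \<Rightarrow> real^3) set" where
  "W = generate (BijGroup UNIV) (insert shift_gen {perm_action \<sigma> | \<sigma>. \<sigma> permutes UNIV})"

definition Gamma_W :: "(real^3 \<Rightarrow> real^3) set" where
  "Gamma_W = {(\<lambda>x. t + w x) | t w. t \<in> Gamma \<and> w \<in> W}"


section \<open>The polyhedron\<close>

definition simplex_A :: "(real^3) set" where
  "simplex_A = {x. pi/2 \<ge> x $ 1 \<and> x $ 1 \<ge> x $ 2 \<and> x $ 2 \<ge> x $ 3 \<and> x $ 3 \<ge> 0}"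

definition simplex_B :: "(real^3) set" where
  "simplex_B = {x. x $ 3 + pi/2 \<ge> x $ 1 \<and> x $ 1 \<ge> pi/2 \<and> pi/2 \<ge> x $ 2 \<and> x $ 2 \<ge> x $ 3}"

definition domain_AB :: "(real^3) set" where
  "domain_AB = simplex_A \<union> simplex_B"

definition pt_P :: "real^3" where "pt_P = vector [pi/2, pi/2, pi/2]"
definition pt_P' :: "real^3" where "pt_P' = vector [pi/2, pi/2, 0]"
definition pt_Q :: "real^3" where "pt_Q = vector [pi/2, 0, 0]"
definition pt_Z :: "real^3" where "pt_Z = pt_P + pt_Q"

definition face_P'QZ :: "(real^3) set" where
  "face_P'QZ = convex hull {pt_P', pt_Q, pt_Z}"

definition face_ZPP' :: "(real^3) set" where
  "face_ZPP' = convex hull {pt_Z, pt_P, pt_P'}"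

definition gamma_map :: "real^3 \<Rightarrow> real^3" where
  "gamma_map x = vector [pi - x $ 1 + x $ 2, pi - x $ 1 + x $ 3, pi - x $ 1]"

text \<open>The supporting hyperplane of a two-dimensional face is its affine hull.\<close>

definition walls :: "(real^3) set set" where
  "walls = {F. F facet_of domain_AB \<and> 0 \<in> affine hull F}"

text \<open>A reflection here is an involution in \<open>W\<close> whose fixed points form the given hyperplane.
  It need not be orthogonal for the standard inner product of \<open>real^3\<close>, which \<open>W\<close> does not
  preserve.\<close>

definition wall_reflection :: "(real^3) set \<Rightarrow> (real^3 \<Rightarrow> real^3) \<Rightarrow> bool" where
  "wall_reflection F s \<longleftrightarrow> s \<in> W \<and> s \<circ> s = id \<and> {x. s x = x} = affine hull F"

text \<open>The face pairings: \<open>gamma_map\<close> on the face \<open>P'QZ\<close>, and on every wall its reflection.\<close>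

definition face_pairing :: "real^3 \<Rightarrow> real^3 \<Rightarrow> bool" where
  "face_pairing x y \<longleftrightarrow>
     (x \<in> face_P'QZ \<and> y = gamma_map x) \<or>
     (\<exists>F\<in>walls. \<exists>s. wall_reflection F s \<and> x \<in> F \<and> y = s x)"

definition gluing_rel :: "((real^3) \<times> (real^3)) set" where
  "gluing_rel = {(x, y). x \<in> domain_AB \<and> y \<in> domain_AB \<and> equivclp face_pairing x y}"

definition glued_space :: "(real^3) set topology" where
  "glued_space = quotient_topology (top_of_set domain_AB) gluing_rel"


section \<open>The real moduli space\<close>

definition symmetric_unitary :: "(complex^4^4) set" where
  "symmetric_unitary = {\<Lambda>. transpose \<Lambda> = \<Lambda> \<and>
     \<Lambda> ** transpose (map_matrix cnj \<Lambda>) = mat 1 \<and> transpose (map_matrix cnj \<Lambda>) ** \<Lambda> = mat 1}"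

definition moduli_action :: "complex \<Rightarrow> real^4^4 \<Rightarrow> complex^4^4 \<Rightarrow> complex^4^4" where
  "moduli_action u V \<Lambda> =
     mat (u\<^sup>2) ** (map_matrix of_real V ** \<Lambda> ** transpose (map_matrix of_real V))"

text \<open>\<^const>\<open>rotation_matrix\<close> is membership in \<open>SO(4)\<close>.\<close>

definition moduli_rel :: "((complex^4^4) \<times> (complex^4^4)) set" where
  "moduli_rel = {(\<Lambda>, \<Lambda>'). \<Lambda> \<in> symmetric_unitary \<and> \<Lambda>' \<in> symmetric_unitary \<and>
     (\<exists>u V. norm u = 1 \<and> rotation_matrix V \<and> \<Lambda>' = moduli_action u V \<Lambda>)}"

definition moduli_space :: "(complex^4^4) set topology" where
  "moduli_space = quotient_topology (top_of_set symmetric_unitary) moduli_rel"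

definition diag_phi :: "real^3 \<Rightarrow> complex^4^4" where
  "diag_phi x = (\<chi> i j. if i = j
     then (vector [1, cis (- 2 * x $ 1), cis (- 2 * x $ 2), cis (- 2 * x $ 3)] :: complex^4) $ i
     else 0)"

end

theory Submission
  imports Defs
begin

text \<open>A point of \<open>\<real>\<^sup>3\<close> together with a zeroth coordinate \<open>0\<close> describes four labelled points on a circle
  of length \<open>\<pi>\<close>, and \<open>W\<close> relabels them, renormalizing the zeroth one to \<open>0\<close> by a rotation. The cyclic
  sequence of gaps is therefore determined up to cyclic shifts, one step of which is \<open>gamma_map\<close>. On
  the pair (sum of the first two gaps minus \<open>\<pi>/2\<close>, sum of the second and third gaps minus \<open>\<pi>/2\<close>) this
  shift acts as a rotation by a quarter turn, and \<open>A \<union> B\<close> is the closed quadrant on which both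
  entries are nonpositive. Hence \<open>A \<union> B\<close> is a fundamental domain, and its only identifications are
  those of its two boundary faces by \<open>gamma_map\<close>.

  Symmetric unitary matrices have commuting symmetric real and imaginary parts, so they are
  diagonalized by rotations, and two diagonal ones are equivalent iff their spectra agree up to a
  rotation of the circle, which is the same relation. As \<open>U(1) \<times> SO(4)\<close> is compact, the resulting
  map from \<open>A \<union> B\<close> to the moduli space is closed, hence a quotient map.\<close>

section \<open>The group \<open>W\<close> as the symmetric group on four letters\<close>

text \<open>For sorted coordinates the gaps are g1 = x3, g2 = x2 - x3, g3 = x1 - x2, g4 = pi - x1,
  so the two sums are s = x2 and t = x1 - x3. Since the gaps add up to pi, moving the last gap to
  the front sends (s, t) to (pi - t, s), whose centre is (pi/2, pi/2); this is the origin of the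
  bound pi/2. The quadrant meets its two neighbours where t = pi/2 and where s = pi/2, which are the
  two glued faces. It meets the opposite quadrant only where s = t = pi/2, on the edge from
  \<open>pt_P'\<close> to \<open>pt_Z\<close>, which \<gamma> squared fixes pointwise. On the three
  walls g1, g2 or g3 vanishes, so two points collide. A reflection fixes its wall pointwise, hence
  it says how the polyhedron is left but identifies nothing. The obstacle is that colliding points
  make the relabelling ambiguous. Two sorted representatives are therefore compared by counting
  points up to a given position, which does not see labels.\<close>

lemma vector_4 [simp]:
  "(vector [a, b, c, d] :: 'a::zero^4) $ 1 = a"
  "(vector [a, b, c, d] :: 'a::zero^4) $ 2 = b"
  "(vector [a, b, c, d] :: 'a::zero^4) $ 3 = c"
  "(vector [a, b, c, d] :: 'a::zero^4) $ 4 = d"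
  by (simp_all add: vector_def)

lemma index_4_cases:
  fixes i :: 4
  obtains "i = 1" | "i = 2" | "i = 3" | "i = 4"
  using exhaust_4 by blast

text \<open>\<open>lift x\<close> lists the coordinates \<open>0, x\<^sub>1, x\<^sub>2, x\<^sub>3\<close> and \<open>weyl \<sigma>\<close> permutes them, followed by the
  translation that makes the first entry \<open>0\<close> again.\<close>

definition lift :: "real^3 \<Rightarrow> 4 \<Rightarrow> real" where
  "lift x i = (vector [0, x $ 1, x $ 2, x $ 3] :: real^4) $ i"

definition weyl :: "(4 \<Rightarrow> 4) \<Rightarrow> real^3 \<Rightarrow> real^3" where
  "weyl \<sigma> x = vector [lift x (\<sigma> 2) - lift x (\<sigma> 1), lift x (\<sigma> 3) - lift x (\<sigma> 1),
     lift x (\<sigma> 4) - lift x (\<sigma> 1)]"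

lemma lift_simps [simp]:
  "lift x 1 = 0" "lift x 2 = x $ 1" "lift x 3 = x $ 2" "lift x 4 = x $ 3"
  by (simp_all add: lift_def)

lemma lift_eq_iff: "lift x = lift y \<longleftrightarrow> x = y"
proof
  assume "lift x = lift y"
  then have "lift x 2 = lift y 2" "lift x 3 = lift y 3" "lift x 4 = lift y 4" by auto
  then show "x = y" by (simp add: vec_eq_iff forall_3)
qed simp

lemma lift_weyl: "lift (weyl \<sigma> x) i = lift x (\<sigma> i) - lift x (\<sigma> 1)"
  by (cases i rule: index_4_cases) (simp_all add: weyl_def)

text \<open>Relabelling is precomposition, hence the reversed order. The inner translation cancels
  because the outer map only uses differences of entries.\<close>

lemma weyl_compose: "weyl \<sigma> \<circ> weyl \<tau> = weyl (\<tau> \<circ> \<sigma>)"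
proof
  fix x
  have "lift ((weyl \<sigma> \<circ> weyl \<tau>) x) = lift (weyl (\<tau> \<circ> \<sigma>) x)"
    by (auto simp: lift_weyl)
  then show "(weyl \<sigma> \<circ> weyl \<tau>) x = weyl (\<tau> \<circ> \<sigma>) x"
    by (simp only: lift_eq_iff)
qed

lemma weyl_id [simp]: "weyl id = id"
  by (rule ext) (simp flip: lift_eq_iff add: lift_weyl fun_eq_iff)

lemma weyl_inv:
  assumes "\<sigma> permutes UNIV"
  shows "weyl \<sigma> \<circ> weyl (inv_into UNIV \<sigma>) = id" "weyl (inv_into UNIV \<sigma>) \<circ> weyl \<sigma> = id"
  using permutes_inv_o[OF assms] by (simp_all add: weyl_compose)

lemma bij_weyl: "\<sigma> permutes UNIV \<Longrightarrow> bij (weyl \<sigma>)"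
  using weyl_inv o_bij by blast

lemma inv_weyl: "\<sigma> permutes UNIV \<Longrightarrow> inv_into UNIV (weyl \<sigma>) = weyl (inv_into UNIV \<sigma>)"
  by (simp add: inv_unique_comp weyl_inv)

text \<open>Embeds the three coordinates among the four letters; letter \<open>1\<close> is the base
  point at \<open>0\<close>.\<close>

definition suc_index :: "3 \<Rightarrow> 4" where
  "suc_index i = (if i = 1 then 2 else if i = 2 then 3 else 4)"

text \<open>The value \<open>3\<close> at letter \<open>1\<close> is a default: wherever that letter
  could occur, a case distinction or the injectivity of the permutation excludes it.\<close>

definition pred_index :: "4 \<Rightarrow> 3" where
  "pred_index i = (if i = 2 then 1 else if i = 3 then 2 else 3)"

lemma suc_index_simps [simp]:
  "suc_index 1 = 2" "suc_index 2 = 3" "suc_index 3 = 4"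
  "pred_index 2 = 1" "pred_index 3 = 2" "pred_index 4 = 3"
  by (simp_all add: suc_index_def pred_index_def)

lemma pred_suc_index [simp]: "pred_index (suc_index i) = i"
  using exhaust_3[of i] by auto

lemma suc_pred_index [simp]: "i \<noteq> 1 \<Longrightarrow> suc_index (pred_index i) = i"
  using exhaust_4[of i] by auto

lemma suc_index_neq_1 [simp]: "suc_index i \<noteq> 1"
  using exhaust_3[of i] by auto

lemma lift_suc_index [simp]: "lift x (suc_index i) = x $ i"
  using exhaust_3[of i] by auto

lemma bij_finite_imp_permutes: "inj (f :: 'a::finite \<Rightarrow> 'a) \<Longrightarrow> f permutes UNIV"
  by (intro bij_imp_permutes) (simp_all add: finite_UNIV_inj_surj bij_def)

lemma perm_action_eq_weyl:
  "perm_action \<sigma> = weyl (\<lambda>i. if i = 1 then 1 else suc_index (\<sigma> (pred_index i)))"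
  by (rule ext) (simp add: perm_action_def weyl_def vec_eq_iff forall_3)

lemma weyl_eq_perm_action:
  assumes "\<sigma> permutes UNIV" "\<sigma> 1 = 1"
  shows "weyl \<sigma> = perm_action (\<lambda>i. pred_index (\<sigma> (suc_index i)))"
proof -
  have "\<sigma> i \<noteq> 1" if "i \<noteq> 1" for i
    using assms that by (metis permutes_inverses(2))
  then have "(\<lambda>i. if i = 1 then 1 else suc_index (pred_index (\<sigma> (suc_index (pred_index i))))) = \<sigma>"
    using assms(2) by (intro ext) auto
  then show ?thesis by (simp add: perm_action_eq_weyl)
qed

lemma shift_gen_eq_weyl: "shift_gen = weyl (Transposition.transpose 1 2)"
  by (rule ext)
    (simp add: shift_gen_def weyl_def vec_eq_iff forall_3 Transposition.transpose_def)

lemma Bij_UNIV: "f \<in> Bij UNIV \<longleftrightarrow> bij f"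
  by (simp add: Bij_def)

lemma mult_BijGroup_UNIV: "bij f \<Longrightarrow> bij g \<Longrightarrow> f \<otimes>\<^bsub>BijGroup UNIV\<^esub> g = f \<circ> g"
  by (simp add: BijGroup_def Bij_UNIV compose_def fun_eq_iff)

text \<open>The generators are the permutations fixing letter \<open>1\<close> and the transposition
  of \<open>1\<close> and \<open>2\<close>. A permutation moving \<open>1\<close> is that
  transposition between two permutations fixing \<open>1\<close>.\<close>

lemma weyl_in_W:
  assumes "\<sigma> permutes UNIV"
  shows "weyl \<sigma> \<in> W"
proof -
  let ?S = "insert shift_gen {perm_action \<sigma> | \<sigma>. \<sigma> permutes UNIV}"
  let ?T = "Transposition.transpose 1 2 :: 4 \<Rightarrow> 4"
  have tr: "?T permutes UNIV"
    by (simp add: permutes_swap_id)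
  have fix1: "weyl \<tau> \<in> generate (BijGroup UNIV) ?S" if \<tau>: "\<tau> permutes UNIV" "\<tau> 1 = 1" for \<tau>
  proof -
    let ?\<tau> = "\<lambda>i. pred_index (\<tau> (suc_index i))"
    have ne: "\<tau> i \<noteq> 1" if "i \<noteq> 1" for i
      using \<tau> that by (metis permutes_inverses(2))
    have "inj ?\<tau>"
    proof (rule injI)
      fix i j assume "?\<tau> i = ?\<tau> j"
      then have "\<tau> (suc_index i) = \<tau> (suc_index j)"
        by (metis ne suc_index_neq_1 suc_pred_index)
      then have "suc_index i = suc_index j"
        using \<tau>(1) by (metis permutes_inverses(2))
      then show "i = j" by (metis pred_suc_index)
    qed
    then have "?\<tau> permutes UNIV" by (rule bij_finite_imp_permutes)
    then show ?thesis
      by (intro generate.incl) (auto simp: weyl_eq_perm_action[OF \<tau>])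
  qed
  have mult: "weyl (\<tau>' \<circ> \<tau>) \<in> generate (BijGroup UNIV) ?S"
    if "\<tau> permutes UNIV" "\<tau>' permutes UNIV" "weyl \<tau> \<in> generate (BijGroup UNIV) ?S"
      "weyl \<tau>' \<in> generate (BijGroup UNIV) ?S" for \<tau> \<tau>'
    using generate.eng[OF that(3,4)] that(1,2)
    by (simp add: mult_BijGroup_UNIV bij_weyl weyl_compose)
  have tr': "weyl ?T \<in> generate (BijGroup UNIV) ?S"
    by (intro generate.incl) (simp add: shift_gen_eq_weyl)
  show ?thesis
  proof (cases "\<sigma> 1 = 1")
    case True
    then show ?thesis unfolding W_def by (intro fix1 assms)
  next
    case False
    \<comment> \<open>Chosen so that \<open>\<sigma> 1\<close> is moved to \<open>2\<close> and then
      by the transposition back to \<open>1\<close>; for \<open>\<sigma> 1 = 2\<close> it is the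
      identity.\<close>
    define \<tau> where "\<tau> = Transposition.transpose 2 (\<sigma> 1)"
    have \<tau>: "\<tau> permutes UNIV" "\<tau> 1 = 1" "\<tau> (\<sigma> 1) = 2" "\<tau> \<circ> \<tau> = id"
      using False by (simp_all add: \<tau>_def permutes_swap_id transpose_apply_other)
    define \<rho> where "\<rho> = ?T \<circ> \<tau> \<circ> \<sigma>"
    have \<rho>: "\<rho> permutes UNIV" "\<rho> 1 = 1"
      unfolding \<rho>_def using \<tau> tr assms by (auto intro!: permutes_compose)
    have "\<tau> \<circ> (?T \<circ> \<rho>) = \<sigma>"
      unfolding \<rho>_def using \<tau>(4) by (simp add: fun_eq_iff)
    moreover have "weyl (\<tau> \<circ> (?T \<circ> \<rho>)) \<in> generate (BijGroup UNIV) ?S"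
      using \<tau> \<rho> tr tr' fix1 by (intro mult permutes_compose) auto
    ultimately show ?thesis by (simp add: W_def)
  qed
qed

text \<open>The maps \<open>weyl \<sigma>\<close> contain the generators and are closed under
  products and inverses, so nothing else is generated.\<close>

lemma W_eq: "W = weyl ` {\<sigma>. \<sigma> permutes UNIV}"
proof
  show "weyl ` {\<sigma>. \<sigma> permutes UNIV} \<subseteq> W" by (auto intro: weyl_in_W)
  have gen: "s \<in> weyl ` {\<sigma>. \<sigma> permutes UNIV}"
    if s: "s \<in> insert shift_gen {perm_action \<sigma> | \<sigma>. \<sigma> permutes UNIV}" for s
  proof (cases "s = shift_gen")
    case True
    then show ?thesis
      by (auto simp: shift_gen_eq_weyl intro!: imageI permutes_swap_id)
  next
    case False
    then obtain \<sigma> where \<sigma>: "s = perm_action \<sigma>" "\<sigma> permutes UNIV" using s by auto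
    let ?\<sigma> = "\<lambda>i. if i = 1 then 1 else suc_index (\<sigma> (pred_index i))"
    have "inj ?\<sigma>"
    proof (rule injI)
      fix i j assume eq: "?\<sigma> i = ?\<sigma> j"
      show "i = j"
      proof (cases "i = 1 \<or> j = 1")
        case True
        then show ?thesis using eq suc_index_neq_1 by (metis (mono_tags))
      next
        case False
        then have "\<sigma> (pred_index i) = \<sigma> (pred_index j)"
          using eq by (metis pred_suc_index)
        then have "pred_index i = pred_index j"
          using \<sigma>(2) by (metis permutes_inverses(2))
        then show ?thesis using False by (metis suc_pred_index)
      qed
    qed
    then have "?\<sigma> permutes UNIV" by (rule bij_finite_imp_permutes)
    then show ?thesis by (auto simp: \<sigma>(1) perm_action_eq_weyl)
  qed
  show "W \<subseteq> weyl ` {\<sigma>. \<sigma> permutes UNIV}"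
  proof
    fix w assume "w \<in> W"
    then show "w \<in> weyl ` {\<sigma>. \<sigma> permutes UNIV}"
      unfolding W_def
    proof (induction rule: generate.induct)
      case one
      have "\<one>\<^bsub>BijGroup UNIV\<^esub> = weyl id" by (auto simp: BijGroup_def)
      then show ?case using permutes_id by blast
    next
      case (incl h)
      then show ?case by (rule gen)
    next
      case (inv h)
      from gen[OF inv] obtain \<sigma> where \<sigma>: "h = weyl \<sigma>" "\<sigma> permutes UNIV" by auto
      then have "inv\<^bsub>BijGroup UNIV\<^esub> h = weyl (inv_into UNIV \<sigma>)"
        by (simp add: inv_BijGroup Bij_UNIV bij_weyl inv_weyl restrict_def)
      then show ?case using \<sigma>(2) permutes_inv by blast
    next
      case (eng h1 h2)
      then obtain \<sigma> \<tau> where "h1 = weyl \<sigma>" "\<sigma> permutes UNIV" "h2 = weyl \<tau>" "\<tau> permutes UNIV" by auto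
      then have "h1 \<otimes>\<^bsub>BijGroup UNIV\<^esub> h2 = weyl (\<tau> \<circ> \<sigma>)" "\<tau> \<circ> \<sigma> permutes UNIV"
        by (simp_all add: mult_BijGroup_UNIV bij_weyl weyl_compose permutes_compose)
      then show ?case by blast
    qed
  qed
qed

section \<open>Four points on a circle up to rotation and relabelling\<close>

text \<open>The rotation \<open>c\<close> stays free so that all four letters are treated alike. In
  this form the relation can be read off both from orbits of \<open>W\<close> on the torus and from
  spectra of diagonal matrices.\<close>

definition config_equiv :: "real^3 \<Rightarrow> real^3 \<Rightarrow> bool" where
  "config_equiv x y \<longleftrightarrow> (\<exists>\<sigma> c. \<sigma> permutes UNIV \<and>
     (\<forall>i. \<exists>k::int. lift y i = lift x (\<sigma> i) + c + pi * of_int k))"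

lemma config_equiv_refl: "config_equiv x x"
  unfolding config_equiv_def
  by (rule exI[of _ id], rule exI[of _ 0]) (auto simp: permutes_id intro!: exI[of _ 0])

lemma config_equiv_sym:
  assumes "config_equiv x y"
  shows "config_equiv y x"
proof -
  from assms obtain \<sigma> c where \<sigma>: "\<sigma> permutes UNIV"
    and k: "\<And>i. \<exists>k::int. lift y i = lift x (\<sigma> i) + c + pi * of_int k"
    by (auto simp: config_equiv_def)
  have "\<exists>k::int. lift x i = lift y (inv_into UNIV \<sigma> i) + - c + pi * of_int k" for i
  proof -
    from k[of "inv_into UNIV \<sigma> i"] obtain k :: int
      where "lift y (inv_into UNIV \<sigma> i) = lift x i + c + pi * of_int k"
      using permutes_inverses(1)[OF \<sigma>] by auto
    then have "lift x i = lift y (inv_into UNIV \<sigma> i) + - c + pi * of_int (- k)" by simp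
    then show ?thesis by blast
  qed
  then show ?thesis
    unfolding config_equiv_def using permutes_inv[OF \<sigma>] by blast
qed

lemma config_equiv_trans:
  assumes "config_equiv x y" "config_equiv y z"
  shows "config_equiv x z"
proof -
  from assms obtain \<sigma> c \<tau> d where \<sigma>: "\<sigma> permutes UNIV" "\<tau> permutes UNIV"
    and k: "\<And>i. \<exists>k::int. lift y i = lift x (\<sigma> i) + c + pi * of_int k"
    and l: "\<And>i. \<exists>k::int. lift z i = lift y (\<tau> i) + d + pi * of_int k"
    by (auto simp: config_equiv_def)
  have "\<exists>k::int. lift z i = lift x ((\<sigma> \<circ> \<tau>) i) + (c + d) + pi * of_int k" for i
  proof -
    obtain m n :: int where "lift z i = lift y (\<tau> i) + d + pi * of_int m"
      "lift y (\<tau> i) = lift x (\<sigma> (\<tau> i)) + c + pi * of_int n"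
      using k l by meson
    then have "lift z i = lift x ((\<sigma> \<circ> \<tau>) i) + (c + d) + pi * of_int (m + n)"
      by (simp add: algebra_simps)
    then show ?thesis by blast
  qed
  then show ?thesis
    unfolding config_equiv_def using permutes_compose[OF \<sigma>(2,1)] by blast
qed

lemma lift_add: "lift (x + y) i = lift x i + lift y i"
  by (cases i rule: index_4_cases) simp_all

lemma lift_Gamma: "t \<in> Gamma \<Longrightarrow> \<exists>k::int. lift t i = pi * of_int k"
  by (cases i rule: index_4_cases) (auto simp: Gamma_def intro: exI[of _ 0])

text \<open>Because \<open>lift y 1 = 0\<close>, the entry at letter \<open>1\<close> fixes
  \<open>c\<close> modulo pi as \<open>- lift x (\<sigma> 1)\<close>, which is exactly the
  renormalization in \<open>weyl\<close>.\<close>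

lemma config_equiv_iff:
  "config_equiv x y \<longleftrightarrow> (\<exists>\<sigma> t. \<sigma> permutes UNIV \<and> t \<in> Gamma \<and> y = t + weyl \<sigma> x)"
proof
  assume "config_equiv x y"
  then obtain \<sigma> c where \<sigma>: "\<sigma> permutes UNIV"
    and "\<And>i. \<exists>k::int. lift y i = lift x (\<sigma> i) + c + pi * of_int k"
    by (auto simp: config_equiv_def)
  then obtain k :: "4 \<Rightarrow> int" where k: "\<And>i. lift y i = lift x (\<sigma> i) + c + pi * of_int (k i)"
    by metis
  have "lift (y - weyl \<sigma> x) i = pi * of_int (k i - k 1)" for i
  proof -
    have "lift y i = lift (y - weyl \<sigma> x) i + lift (weyl \<sigma> x) i"
      by (simp flip: lift_add)
    then show ?thesis using k[of i] k[of 1]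
      by (simp add: lift_weyl algebra_simps)
  qed
  then have "(y - weyl \<sigma> x) $ i = pi * of_int (k (suc_index i) - k 1)" for i
    by (metis lift_suc_index)
  then have "y - weyl \<sigma> x \<in> Gamma"
    unfolding Gamma_def by blast
  then show "\<exists>\<sigma> t. \<sigma> permutes UNIV \<and> t \<in> Gamma \<and> y = t + weyl \<sigma> x"
    using \<sigma> by (intro exI[of _ \<sigma>] exI[of _ "y - weyl \<sigma> x"]) auto
next
  assume "\<exists>\<sigma> t. \<sigma> permutes UNIV \<and> t \<in> Gamma \<and> y = t + weyl \<sigma> x"
  then obtain \<sigma> t where \<sigma>: "\<sigma> permutes UNIV" "t \<in> Gamma" "y = t + weyl \<sigma> x" by blast
  have "\<exists>k::int. lift y i = lift x (\<sigma> i) + - lift x (\<sigma> 1) + pi * of_int k" for i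
    using lift_Gamma[OF \<sigma>(2), of i] by (auto simp: \<sigma>(3) lift_add lift_weyl)
  then show "config_equiv x y" unfolding config_equiv_def using \<sigma>(1) by blast
qed

lemma zero_in_Gamma: "0 \<in> Gamma"
  by (auto simp: Gamma_def intro: exI[of _ 0])

lemma config_equiv_weyl: "\<sigma> permutes UNIV \<Longrightarrow> config_equiv x (weyl \<sigma> x)"
  unfolding config_equiv_iff using zero_in_Gamma by force

lemma config_equiv_translate: "y - x \<in> Gamma \<Longrightarrow> config_equiv x y"
  unfolding config_equiv_iff using permutes_id
  by (intro exI[of _ id] exI[of _ "y - x"]) auto

text \<open>The cyclic relabelling makes \<open>x $ 1\<close>, the last point of a sorted
  configuration, the new base point; the translation by pi brings the differences, nonpositive for
  sorted points, back into one turn.\<close>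

lemma gamma_map_eq:
  "gamma_map x = vector [pi, pi, pi] + weyl (\<lambda>i. i + 1) x"
proof -
  \<comment> \<open>Numerals of type \<open>4\<close> wrap around, so the successor of letter
    \<open>4\<close> is letter \<open>1\<close>.\<close>
  have 5: "(5::4) = 1" by simp
  show ?thesis
    by (simp add: gamma_map_def weyl_def vec_eq_iff forall_3 5)
qed

lemma gamma_perm: "(\<lambda>i::4. i + 1) permutes UNIV"
  by (rule bij_finite_imp_permutes) (simp add: inj_def)

lemma vector_pi_in_Gamma: "vector [pi, pi, pi] \<in> Gamma"
  by (auto simp: Gamma_def forall_3 intro!: exI[of _ 1])

lemma gamma_map_in_Gamma_W: "gamma_map \<in> Gamma_W"
  unfolding Gamma_W_def W_eq using gamma_map_eq gamma_perm vector_pi_in_Gamma by fastforce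

lemma config_equiv_gamma_map: "config_equiv x (gamma_map x)"
  unfolding config_equiv_iff using gamma_map_eq gamma_perm vector_pi_in_Gamma by blast

text \<open>Sorted representatives of a configuration are enumerated by a monotone sequence
  indexed by the integers, with period \<open>4\<close> up to a full turn \<open>pi\<close>.\<close>

definition sorted_config :: "real^3 \<Rightarrow> bool" where
  "sorted_config x \<longleftrightarrow> 0 \<le> x $ 3 \<and> x $ 3 \<le> x $ 2 \<and> x $ 2 \<le> x $ 1 \<and> x $ 1 \<le> pi"

definition enum_config :: "real^3 \<Rightarrow> int \<Rightarrow> real" where
  "enum_config x n = pi * of_int (n div 4) +
     (if n mod 4 = 0 then 0 else if n mod 4 = 1 then x $ 3
      else if n mod 4 = 2 then x $ 2 else x $ 1)"

text \<open>Up to an additive constant, this counts the lifts of the four points to the line that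
  are at most \<open>z\<close>. As a sum over letters it is insensitive to their order, also when
  points coincide.\<close>

definition count_config :: "real^3 \<Rightarrow> real \<Rightarrow> int" where
  "count_config x z = (\<Sum>i\<in>UNIV. \<lfloor>(z - lift x i) / pi\<rfloor>)"

lemma floor_turns:
  assumes "0 \<le> a" "a \<le> pi" "0 \<le> z" "z < pi"
  shows "\<lfloor>(z + pi * of_int q - a) / pi\<rfloor> = q + (if a \<le> z then 0 else - 1)"
proof -
  have "(z + pi * of_int q - a) / pi = (z - a) / pi + of_int q"
    by (simp add: field_simps)
  moreover have "\<lfloor>(z - a) / pi\<rfloor> = (if a \<le> z then 0 else - 1)"
    using assms by (intro floor_unique) (auto simp: field_simps)
  ultimately show ?thesis by simp
qed

text \<open>A Galois connection: the counting function determines the enumeration.\<close>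

lemma count_config_ge_iff:
  assumes "sorted_config x"
  shows "n - 3 \<le> count_config x z \<longleftrightarrow> enum_config x n \<le> z"
proof -
  define q where "q = \<lfloor>z / pi\<rfloor>"
  define w where "w = z - pi * of_int q"
  have w: "0 \<le> w" "w < pi" and z: "z = w + pi * of_int q"
    using floor_divide_lower[of pi z] floor_divide_upper[of pi z]
    by (simp_all add: w_def q_def algebra_simps)
  define m r where "m = n div 4" and "r = n mod 4"
  have n: "n = 4 * m + r" and r: "r = 0 \<or> r = 1 \<or> r = 2 \<or> r = 3"
    unfolding m_def r_def by (simp, presburger)
  have x: "0 \<le> x $ 3" "x $ 3 \<le> x $ 2" "x $ 2 \<le> x $ 1" "x $ 1 \<le> pi"
    using assms by (auto simp: sorted_config_def)
  \<comment> \<open>The base point contributes \<open>q\<close> and every other point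
    \<open>q\<close> or \<open>q - 1\<close>. Before any other point of the turn is reached the
    count is thus \<open>4 * q - 3\<close>, while the index reached is \<open>4 * q\<close>: this is
    the offset \<open>3\<close> in the statement.\<close>
  have count: "count_config x z = 4 * q + (if x $ 1 \<le> w then 0 else - 1)
      + (if x $ 2 \<le> w then 0 else - 1) + (if x $ 3 \<le> w then 0 else - 1)"
    unfolding count_config_def sum_4 z using x w
    by (simp only: lift_simps floor_turns) (simp add: floor_turns)
  define a where "a = (if r = 0 then 0 else if r = 1 then x $ 3
      else if r = 2 then x $ 2 else x $ 1)"
  have enum: "enum_config x n = pi * of_int m + a"
    by (simp add: enum_config_def m_def r_def a_def)
  have a: "0 \<le> a" "a \<le> pi" using x by (auto simp: a_def)
  consider "m < q" | "m = q" | "q < m" by linarith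
  then show ?thesis
  proof cases
    case 1
    then have "pi * of_int (m + 1) \<le> pi * of_int q" by (intro mult_left_mono) auto
    then have "enum_config x n \<le> z"
      using a w by (simp add: enum z algebra_simps)
    moreover have "n - 3 \<le> count_config x z"
      using 1 r unfolding count n by auto
    ultimately show ?thesis by simp
  next
    case 2
    then show ?thesis using x w r unfolding enum count unfolding n a_def z by auto
  next
    case 3
    then have "pi * of_int (q + 1) \<le> pi * of_int m" by (intro mult_left_mono) auto
    then have "\<not> enum_config x n \<le> z"
      using a w by (simp add: enum z algebra_simps)
    moreover have "\<not> n - 3 \<le> count_config x z"
      using 3 r unfolding count n by auto
    ultimately show ?thesis by simp
  qed
qed

lemma enum_config_shift: "enum_config x (n + 4 * m) = enum_config x n + pi * of_int m"
  by (simp add: enum_config_def algebra_simps)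

text \<open>Relabelling permutes the summands of the count, and full turns change it by their total
  \<open>K\<close>. A constant change of the count is a shift of the index under the Galois
  connection.\<close>

lemma enum_config_cyclic:
  assumes x: "sorted_config x" and y: "sorted_config y" and \<sigma>: "\<sigma> permutes UNIV"
    and k: "\<And>i. lift y i = lift x (\<sigma> i) + c + pi * of_int (k i)"
  shows "\<exists>d. \<forall>n. enum_config y (n + d) = enum_config x n + c"
proof -
  define K where "K = (\<Sum>i\<in>UNIV. k i)"
  have count: "count_config y (z + c) = count_config x z - K" for z
  proof -
    have "\<lfloor>(z + c - lift y i) / pi\<rfloor> = \<lfloor>(z - lift x (\<sigma> i)) / pi\<rfloor> - k i" for i
    proof -
      have "(z + c - lift y i) / pi = (z - lift x (\<sigma> i)) / pi - of_int (k i)"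
        by (simp add: k field_simps)
      then show ?thesis by simp
    qed
    then have "count_config y (z + c) = (\<Sum>i\<in>UNIV. \<lfloor>(z - lift x (\<sigma> i)) / pi\<rfloor>) - K"
      by (simp add: count_config_def K_def sum_subtractf)
    also have "(\<Sum>i\<in>UNIV. \<lfloor>(z - lift x (\<sigma> i)) / pi\<rfloor>) = count_config x z"
      unfolding count_config_def
      by (rule sum.reindex_bij_betw[OF permutes_imp_bij[OF \<sigma>]])
    finally show ?thesis .
  qed
  have iff: "enum_config y (n - K) \<le> z + c \<longleftrightarrow> enum_config x n \<le> z" for n z
    using count_config_ge_iff[OF y, of "n - K" "z + c"] count_config_ge_iff[OF x, of n z]
    by (auto simp: count)
  \<comment> \<open>Equal upper sets have equal least elements; taking \<open>z\<close> at either of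
    the two values gives the two inequalities.\<close>
  have "enum_config y (n + - K) = enum_config x n + c" for n
    using iff[of n "enum_config x n"] iff[of n "enum_config y (n - K) - c"] by simp
  then show ?thesis by blast
qed

section \<open>Equivalent sorted configurations and their representatives in the polyhedron\<close>

lemma gamma_map_simps [simp]:
  "gamma_map x $ 1 = pi - x $ 1 + x $ 2" "gamma_map x $ 2 = pi - x $ 1 + x $ 3"
  "gamma_map x $ 3 = pi - x $ 1"
  by (simp_all add: gamma_map_def)

text \<open>Full turns are absorbed into the rotation, so only the index shift modulo
  \<open>4\<close> matters, and it is the exponent of \<gamma>. Three steps forward are written as
  one step back. The information on \<open>c\<close> in the first case serves to recover the
  permutation of an interior point.\<close>

lemma sorted_config_fiber:
  assumes x: "sorted_config x" and y: "sorted_config y" and \<sigma>: "\<sigma> permutes UNIV"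
    and k: "\<And>i. lift y i = lift x (\<sigma> i) + c + pi * of_int (k i)"
  shows "(y = x \<and> (\<exists>m::int. c = pi * of_int m)) \<or> y = gamma_map x \<or>
    y = gamma_map (gamma_map x) \<or> x = gamma_map y"
proof -
  from enum_config_cyclic[OF assms] obtain d
    where d: "\<And>n. enum_config y (n + d) = enum_config x n + c" by blast
  define m r where "m = d div 4" and "r = d mod 4"
  define e where "e = c - pi * of_int m"
  have dmr: "d = r + 4 * m" and r: "r = 0 \<or> r = 1 \<or> r = 2 \<or> r = 3"
    unfolding m_def r_def by (simp, presburger)
  have e: "enum_config y (n + r) = enum_config x n + e" for n
    using d[of n] enum_config_shift[of y "n + r" m] by (simp add: dmr e_def algebra_simps)
  note eqs = e[of 0] e[of 1] e[of 2] e[of 3]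
  from r show ?thesis
  proof (elim disjE)
    assume "r = 0"
    then have "y = x" "e = 0"
      using eqs by (simp_all add: enum_config_def vec_eq_iff forall_3)
    then show ?thesis by (auto simp: e_def)
  next
    assume "r = 1"
    then have "y = gamma_map x"
      using eqs by (simp add: enum_config_def vec_eq_iff forall_3)
    then show ?thesis by simp
  next
    assume "r = 2"
    then have "y = gamma_map (gamma_map x)"
      using eqs by (simp add: enum_config_def vec_eq_iff forall_3)
    then show ?thesis by simp
  next
    assume "r = 3"
    then have "x = gamma_map y"
      using eqs by (simp add: enum_config_def vec_eq_iff forall_3)
    then show ?thesis by simp
  qed
qed

text \<open>The plane through the common face, where the first coordinate is pi/2, drops out: in
  \<open>simplex_A\<close> the last inequality is automatic, and in \<open>simplex_B\<close>
  nonnegativity of \<open>x $ 3\<close> follows from the two bounds on \<open>x $ 1\<close>. Hence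
  the union is convex.\<close>

lemma domain_AB_iff:
  "x \<in> domain_AB \<longleftrightarrow> 0 \<le> x $ 3 \<and> x $ 3 \<le> x $ 2 \<and> x $ 2 \<le> x $ 1 \<and> x $ 2 \<le> pi / 2 \<and>
     x $ 1 \<le> x $ 3 + pi / 2"
  unfolding domain_AB_def simplex_A_def simplex_B_def by auto

lemma domain_AB_sorted: "x \<in> domain_AB \<Longrightarrow> sorted_config x"
  by (auto simp: domain_AB_iff sorted_config_def)

text \<open>If \<gamma> squared maps a point of the quadrant into the quadrant, both gap sums equal
  pi/2, opposite gaps agree, and the point is fixed. A single step back into the quadrant forces the
  second sum, \<open>x $ 1 - x $ 3\<close>, to be pi/2.\<close>

lemma domain_AB_fiber:
  assumes x: "x \<in> domain_AB" and y: "y \<in> domain_AB" and "config_equiv x y"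
  shows "y = x \<or> (x $ 1 = x $ 3 + pi / 2 \<and> y = gamma_map x) \<or>
    (y $ 1 = y $ 3 + pi / 2 \<and> x = gamma_map y)"
proof -
  from assms(3) obtain \<sigma> c where \<sigma>: "\<sigma> permutes UNIV"
    and "\<And>i. \<exists>k::int. lift y i = lift x (\<sigma> i) + c + pi * of_int k"
    by (auto simp: config_equiv_def)
  then obtain k :: "4 \<Rightarrow> int" where k: "\<And>i. lift y i = lift x (\<sigma> i) + c + pi * of_int (k i)"
    by metis
  have "y = x \<or> y = gamma_map x \<or> y = gamma_map (gamma_map x) \<or> x = gamma_map y"
    using sorted_config_fiber[OF domain_AB_sorted[OF x] domain_AB_sorted[OF y] \<sigma> k] by blast
  then show ?thesis
    using x y by (elim disjE) (auto simp: domain_AB_iff vec_eq_iff forall_3)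
qed

text \<open>If both gap sums of \<open>x\<close> are below pi/2, every nontrivial power of \<gamma>
  makes one of them exceed pi/2. So the rotation consists of full turns, and four distinct points of
  a half-open turn cannot be permuted by it.\<close>

lemma domain_AB_rigid:
  assumes x: "0 < x $ 3" "x $ 3 < x $ 2" "x $ 2 < x $ 1" "x $ 2 < pi / 2" "x $ 1 < x $ 3 + pi / 2"
    and y: "y \<in> domain_AB" and \<sigma>: "\<sigma> permutes UNIV"
    and k: "\<And>i. \<exists>k::int. lift y i = lift x (\<sigma> i) + c + pi * of_int k"
  shows "\<sigma> = id"
proof -
  have xD: "x \<in> domain_AB" using x by (auto simp: domain_AB_iff)
  from k obtain k :: "4 \<Rightarrow> int" where k: "\<And>i. lift y i = lift x (\<sigma> i) + c + pi * of_int (k i)"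
    by metis
  have "y = x \<and> (\<exists>m::int. c = pi * of_int m)"
    using sorted_config_fiber[OF domain_AB_sorted[OF xD] domain_AB_sorted[OF y] \<sigma> k] x y
    by (auto simp: domain_AB_iff)
  then obtain m :: int where yx: "y = x" and m: "c = pi * of_int m" by blast
  have range: "0 \<le> lift x i \<and> lift x i < pi" for i
    using x by (cases i rule: index_4_cases) auto
  have inj: "i = j" if "lift x i = lift x j" for i j
    using that x by (cases i rule: index_4_cases; cases j rule: index_4_cases) auto
  show ?thesis
  proof
    fix i
    have eq: "lift x i - lift x (\<sigma> i) = pi * of_int (m + k i)"
      using k[of i] by (simp add: yx m algebra_simps)
    have "\<bar>lift x i - lift x (\<sigma> i)\<bar> < pi" using range[of i] range[of "\<sigma> i"] by linarith
    then have "\<bar>of_int (m + k i) :: real\<bar> < 1"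
      unfolding eq abs_mult by (simp add: field_simps)
    then have "m + k i = 0" by linarith
    then have "lift x i = lift x (\<sigma> i)" using eq by simp
    then show "\<sigma> i = id i" using inj by simp
  qed
qed

text \<open>After reduction modulo pi and sorting, the powers of \<gamma> rotate the pair of gap
  sums through all four quadrants.\<close>

lemma config_equiv_domain_AB: "\<exists>y\<in>domain_AB. config_equiv x y"
proof -
  have swap: "config_equiv x (vector [b, a, c])" "config_equiv x (vector [a, c, b])"
    if "config_equiv x (vector [a, b, c])" for a b c
  proof -
    have "weyl (Transposition.transpose 2 3) (vector [a, b, c]) = vector [b, a, c]"
      "weyl (Transposition.transpose 3 4) (vector [a, b, c]) = vector [a, c, b]"
      by (simp_all add: weyl_def vec_eq_iff forall_3 Transposition.transpose_def)
    then show "config_equiv x (vector [b, a, c])" "config_equiv x (vector [a, c, b])"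
      using config_equiv_trans[OF that] config_equiv_weyl permutes_swap_id UNIV_I
      by metis+
  qed
  define r :: "3 \<Rightarrow> real" where "r i = x $ i - pi * of_int \<lfloor>x $ i / pi\<rfloor>" for i
  have r: "0 \<le> r i" "r i < pi" for i
    using floor_divide_lower[of pi "x $ i"] floor_divide_upper[of pi "x $ i"]
    by (simp_all add: r_def algebra_simps)
  have "\<exists>k::int. - (pi * of_int \<lfloor>a\<rfloor>) = pi * of_int k" for a :: real
    by (rule exI[of _ "- \<lfloor>a\<rfloor>"]) simp
  then have "vector [r 1, r 2, r 3] - x \<in> Gamma"
    by (simp add: Gamma_def forall_3 r_def)
  then have base: "config_equiv x (vector [r 1, r 2, r 3])" by (rule config_equiv_translate)
  have "\<exists>a b c. config_equiv x (vector [a, b, c]) \<and> 0 \<le> c \<and> c \<le> b \<and> b \<le> a \<and> a \<le> pi"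
  proof -
    \<comment> \<open>Adjacent swaps applied up to three times produce all six orderings of the
      coordinates.\<close>
    note perms = base swap[OF base] swap[OF swap(1)[OF base]] swap[OF swap(2)[OF base]]
      swap[OF swap(2)[OF swap(1)[OF base]]] swap[OF swap(1)[OF swap(2)[OF base]]]
    show ?thesis
      using perms r[of 1] r[of 2] r[of 3]
      by (meson less_imp_le linear)
  qed
  then obtain a b c where "config_equiv x (vector [a, b, c])" "0 \<le> c" "c \<le> b" "b \<le> a" "a \<le> pi"
    by blast
  then obtain y where y: "config_equiv x y" "sorted_config y"
    unfolding sorted_config_def by (metis vector_3)
  define g where "g = gamma_map"
  have equiv: "config_equiv x (g y)" "config_equiv x (g (g y))" "config_equiv x (g (g (g y)))"
    unfolding g_def by (meson y(1) config_equiv_trans config_equiv_gamma_map)+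
  have "y \<in> domain_AB \<or> g y \<in> domain_AB \<or> g (g y) \<in> domain_AB \<or> g (g (g y)) \<in> domain_AB"
    using y(2) unfolding sorted_config_def domain_AB_iff g_def by auto
  then show ?thesis using y(1) equiv by blast
qed

section \<open>Polyhedra given by halfspaces\<close>

definition halfspaces_Int :: "('a::euclidean_space \<times> real) set \<Rightarrow> 'a set" where
  "halfspaces_Int I = {x. \<forall>(a, b)\<in>I. a \<bullet> x \<le> b}"

lemma halfspaces_Int_eq: "halfspaces_Int I = (\<Inter>(a, b)\<in>I. {x. a \<bullet> x \<le> b})"
  by (auto simp: halfspaces_Int_def)

lemma convex_halfspaces_Int: "convex (halfspaces_Int I)"
  unfolding halfspaces_Int_eq by (intro convex_INT) (auto simp: convex_halfspace_le)

lemma interior_halfspaces_Int: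
  assumes "finite I" and nz: "\<And>a b. (a, b) \<in> I \<Longrightarrow> a \<noteq> 0"
  shows "interior (halfspaces_Int I) = {x. \<forall>(a, b)\<in>I. a \<bullet> x < b}" (is "_ = ?S")
proof
  have "?S = (\<Inter>(a, b)\<in>I. {x. a \<bullet> x < b})" by auto
  moreover have "open (\<Inter>(a, b)\<in>I. {x. a \<bullet> x < b})"
    using \<open>finite I\<close> by (intro open_INT) (auto simp: open_halfspace_lt)
  ultimately show "?S \<subseteq> interior (halfspaces_Int I)"
    by (intro interior_maximal) (auto simp: halfspaces_Int_def less_imp_le)
  show "interior (halfspaces_Int I) \<subseteq> ?S"
  proof clarify
    fix x a b assume x: "x \<in> interior (halfspaces_Int I)" and ab: "(a, b) \<in> I"
    have "halfspaces_Int I \<subseteq> {x. a \<bullet> x \<le> b}" using ab by (auto simp: halfspaces_Int_def)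
    then have "x \<in> interior {x. a \<bullet> x \<le> b}" using x interior_mono by blast
    then show "a \<bullet> x < b" using interior_halfspace_le[OF nz[OF ab]] by auto
  qed
qed

text \<open>Facets can be read off an irredundant description only. Irredundancy is witnessed by
  points violating exactly one inequality, and nonempty interior makes the affine hull the whole
  space.\<close>

lemma facet_of_halfspaces_Int:
  assumes fin: "finite I" and int: "interior (halfspaces_Int I) \<noteq> {}"
    and nz: "\<And>a b. (a, b) \<in> I \<Longrightarrow> a \<noteq> 0"
    and irr: "\<And>a b. (a, b) \<in> I \<Longrightarrow>
      \<exists>p. b < a \<bullet> p \<and> (\<forall>(a', b')\<in>I. (a', b') \<noteq> (a, b) \<longrightarrow> a' \<bullet> p \<le> b')"
  shows "C facet_of halfspaces_Int I \<longleftrightarrow>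
    (\<exists>(a, b)\<in>I. C = halfspaces_Int I \<inter> {x. a \<bullet> x = b})"
proof -
  define H where "H = (\<lambda>(a :: 'a, b). {x. a \<bullet> x \<le> b})"
  \<comment> \<open>Facets are first indexed by halfspaces; this inverse recovers normal and bound.
    The witnesses show that different inequalities give different halfspaces.\<close>
  define g where "g = inv_into I H"
  have witness: "\<exists>p. p \<notin> H i \<and> (\<forall>j\<in>I. j \<noteq> i \<longrightarrow> p \<in> H j)" if iI: "i \<in> I" for i
  proof -
    obtain a b where i: "i = (a, b)" by (cases i)
    obtain p where p: "b < a \<bullet> p" "\<forall>(a', b')\<in>I. (a', b') \<noteq> (a, b) \<longrightarrow> a' \<bullet> p \<le> b'"
      using irr[of a b] iI i by auto
    have "p \<notin> H i" using p(1) by (simp add: H_def i)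
    moreover have "\<forall>j\<in>I. j \<noteq> i \<longrightarrow> p \<in> H j"
      using p(2) by (auto simp: H_def i)
    ultimately show ?thesis by blast
  qed
  have inj: "inj_on H I"
    by (rule inj_onI) (metis witness)
  have g: "g (H i) = i" if "i \<in> I" for i
    using inj that by (simp add: g_def)
  have aff: "affine hull halfspaces_Int I = UNIV"
    using int by (rule affine_hull_nonempty_interior)
  have S: "halfspaces_Int I = \<Inter> (H ` I)"
    by (auto simp: halfspaces_Int_eq H_def)
  have "C facet_of halfspaces_Int I \<longleftrightarrow> (\<exists>h. h \<in> H ` I \<and>
      C = halfspaces_Int I \<inter> {x. (fst \<circ> g) h \<bullet> x = (snd \<circ> g) h})"
  proof (rule facet_of_polyhedron_explicit)
    show "finite (H ` I)" using fin by simp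
    show "halfspaces_Int I = affine hull halfspaces_Int I \<inter> \<Inter> (H ` I)"
      using S aff by simp
    show "(fst \<circ> g) h \<noteq> 0 \<and> h = {x. (fst \<circ> g) h \<bullet> x \<le> (snd \<circ> g) h}" if "h \<in> H ` I" for h
      using that g nz by (auto simp: H_def)
    show "halfspaces_Int I \<subset> affine hull halfspaces_Int I \<inter> \<Inter> F'" if F': "F' \<subset> H ` I" for F'
    proof -
      obtain i where i: "i \<in> I" "H i \<notin> F'" using F' by blast
      obtain p where p: "p \<notin> H i" "\<And>j. j \<in> I \<Longrightarrow> j \<noteq> i \<Longrightarrow> p \<in> H j"
        using witness[OF i(1)] by blast
      have "p \<in> \<Inter> F'" using F' i(2) p(2) by blast
      moreover have "p \<notin> halfspaces_Int I" using p(1) i(1) unfolding S by blast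
      moreover have "halfspaces_Int I \<subseteq> \<Inter> F'" using F' unfolding S by blast
      ultimately show ?thesis unfolding aff by blast
    qed
  qed
  also have "\<dots> \<longleftrightarrow> (\<exists>i\<in>I. C = halfspaces_Int I \<inter> {x. fst i \<bullet> x = snd i})"
    using g by auto
  finally show ?thesis by (simp add: case_prod_beta)
qed

lemma convex_combination_4:
  fixes a b c d :: "'a::real_vector"
  assumes "convex K" "a \<in> K" "b \<in> K" "c \<in> K" "d \<in> K"
    and "0 \<le> u" "0 \<le> v" "0 \<le> w" "0 \<le> t" "u + v + w + t = 1"
  shows "u *\<^sub>R a + v *\<^sub>R b + w *\<^sub>R c + t *\<^sub>R d \<in> K"
proof -
  have "(\<Sum>i<4. [u, v, w, t] ! i *\<^sub>R [a, b, c, d] ! i) \<in> K"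
    using assms by (intro convex_sum) (auto simp: eval_nat_numeral less_Suc_eq)
  then show ?thesis by (simp add: eval_nat_numeral)
qed

lemma simplex_3I:
  fixes a b c d :: "'a::euclidean_space"
  assumes ind: "\<And>u v w t. u + v + w + t = 0 \<Longrightarrow>
      u *\<^sub>R a + v *\<^sub>R b + w *\<^sub>R c + t *\<^sub>R d = 0 \<Longrightarrow> u = 0 \<and> v = 0 \<and> w = 0 \<and> t = 0"
  shows "3 simplex (convex hull {a, b, c, d})"
proof -
  \<comment> \<open>Coefficients \<open>1\<close> and \<open>-1\<close> on two equal vertices would
    be a nontrivial affine relation.\<close>
  have distinct: "a \<noteq> b" "a \<noteq> c" "a \<noteq> d" "b \<noteq> c" "b \<noteq> d" "c \<noteq> d"
    using ind[of 1 "-1" 0 0] ind[of 1 0 "-1" 0] ind[of 1 0 0 "-1"] ind[of 0 1 "-1" 0]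
      ind[of 0 1 0 "-1"] ind[of 0 0 1 "-1"] by auto
  have "\<not> affine_dependent {a, b, c, d}"
  proof (subst affine_dependent_explicit_finite, simp, clarify)
    fix U v
    assume 1: "sum U {a, b, c, d} = 0" "(\<Sum>v\<in>{a, b, c, d}. U v *\<^sub>R v) = 0"
      and v: "v \<in> {a, b, c, d}" "U v \<noteq> 0"
    have "U a = 0 \<and> U b = 0 \<and> U c = 0 \<and> U d = 0"
      using 1 distinct by (intro ind) (simp_all add: add.assoc)
    then show False using v by auto
  qed
  moreover have "int (card {a, b, c, d}) = 3 + 1" using distinct by simp
  ultimately show ?thesis by (intro simplex_convex_hull) auto
qed


section \<open>The polyhedron and its facets\<close>

lemma inner_vector_3: "vector [a, b, c] \<bullet> (x :: real^3) = a * x $ 1 + b * x $ 2 + c * x $ 3"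
  by (simp add: inner_vec_def sum_3)

lemma pt_simps [simp]:
  "pt_P $ 1 = pi / 2" "pt_P $ 2 = pi / 2" "pt_P $ 3 = pi / 2"
  "pt_P' $ 1 = pi / 2" "pt_P' $ 2 = pi / 2" "pt_P' $ 3 = 0"
  "pt_Q $ 1 = pi / 2" "pt_Q $ 2 = 0" "pt_Q $ 3 = 0"
  "pt_Z $ 1 = pi" "pt_Z $ 2 = pi / 2" "pt_Z $ 3 = pi / 2"
  by (simp_all add: pt_P_def pt_P'_def pt_Q_def pt_Z_def)

lemma simplex_A_hull: "simplex_A = convex hull {0, pt_Q, pt_P', pt_P}"
proof
  show "simplex_A \<subseteq> convex hull {0, pt_Q, pt_P', pt_P}"
  proof
    fix x assume "x \<in> simplex_A"
    \<comment> \<open>The barycentric coordinates are the slacks in the chain of inequalities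
      defining the simplex, divided by pi/2; each belongs to the vertex opposite to its
      facet.\<close>
    then have "(1 - 2 * x $ 1 / pi) *\<^sub>R 0 + (2 * (x $ 1 - x $ 2) / pi) *\<^sub>R pt_Q
        + (2 * (x $ 2 - x $ 3) / pi) *\<^sub>R pt_P' + (2 * x $ 3 / pi) *\<^sub>R pt_P
        \<in> convex hull {0, pt_Q, pt_P', pt_P}"
      by (intro convex_combination_4)
        (auto simp: simplex_A_def hull_inc divide_simps algebra_simps)
    also have "(1 - 2 * x $ 1 / pi) *\<^sub>R 0 + (2 * (x $ 1 - x $ 2) / pi) *\<^sub>R pt_Q
        + (2 * (x $ 2 - x $ 3) / pi) *\<^sub>R pt_P' + (2 * x $ 3 / pi) *\<^sub>R pt_P = x"
      by (simp add: vec_eq_iff forall_3 field_simps)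
    finally show "x \<in> convex hull {0, pt_Q, pt_P', pt_P}" .
  qed
  have "simplex_A = halfspaces_Int {(vector [1, 0, 0], pi / 2), (vector [- 1, 1, 0], 0),
      (vector [0, - 1, 1], 0), (vector [0, 0, - 1], 0)}"
    by (auto simp: simplex_A_def halfspaces_Int_def inner_vector_3)
  then have "convex simplex_A" using convex_halfspaces_Int by metis
  then show "convex hull {0, pt_Q, pt_P', pt_P} \<subseteq> simplex_A"
    by (intro hull_minimal) (auto simp: simplex_A_def)
qed

lemma simplex_B_hull: "simplex_B = convex hull {pt_Z, pt_Q, pt_P', pt_P}"
proof
  show "simplex_B \<subseteq> convex hull {pt_Z, pt_Q, pt_P', pt_P}"
  proof
    fix x assume "x \<in> simplex_B"
    \<comment> \<open>Again the four slacks divided by pi/2.\<close>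
    then have "(2 * x $ 1 / pi - 1) *\<^sub>R pt_Z + (1 - 2 * x $ 2 / pi) *\<^sub>R pt_Q
        + (2 * (x $ 2 - x $ 3) / pi) *\<^sub>R pt_P' + (1 - 2 * (x $ 1 - x $ 3) / pi) *\<^sub>R pt_P
        \<in> convex hull {pt_Z, pt_Q, pt_P', pt_P}"
      by (intro convex_combination_4)
        (auto simp: simplex_B_def hull_inc divide_simps algebra_simps)
    also have "(2 * x $ 1 / pi - 1) *\<^sub>R pt_Z + (1 - 2 * x $ 2 / pi) *\<^sub>R pt_Q
        + (2 * (x $ 2 - x $ 3) / pi) *\<^sub>R pt_P' + (1 - 2 * (x $ 1 - x $ 3) / pi) *\<^sub>R pt_P = x"
      by (simp add: vec_eq_iff forall_3 field_simps)
    finally show "x \<in> convex hull {pt_Z, pt_Q, pt_P', pt_P}" .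
  qed
  have "simplex_B = halfspaces_Int {(vector [1, 0, - 1], pi / 2), (vector [- 1, 0, 0], - pi / 2),
      (vector [0, 1, 0], pi / 2), (vector [0, - 1, 1], 0)}"
    by (auto simp: simplex_B_def halfspaces_Int_def inner_vector_3)
  then have "convex simplex_B" using convex_halfspaces_Int by metis
  then show "convex hull {pt_Z, pt_Q, pt_P', pt_P} \<subseteq> simplex_B"
    by (intro hull_minimal) (auto simp: simplex_B_def)
qed

lemma simplex_A: "3 simplex simplex_A"
  unfolding simplex_A_hull
  by (rule simplex_3I) (auto simp: vec_eq_iff forall_3 divide_simps algebra_simps)

lemma simplex_B: "3 simplex simplex_B"
  unfolding simplex_B_hull
proof (rule simplex_3I)
  fix u v w t :: real
  assume 0: "u + v + w + t = 0"
    and "u *\<^sub>R pt_Z + v *\<^sub>R pt_Q + w *\<^sub>R pt_P' + t *\<^sub>R pt_P = 0"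
  then have "(2 * u + v + w + t) * (pi / 2) = 0" "(u + w + t) * (pi / 2) = 0" "(u + t) * (pi / 2) = 0"
    by (simp_all add: vec_eq_iff forall_3 algebra_simps)
  then have "2 * u + v + w + t = 0" "u + w + t = 0" "u + t = 0" by simp_all
  then show "u = 0 \<and> v = 0 \<and> w = 0 \<and> t = 0" using 0 by linarith
qed

text \<open>The homogeneous inequalities belong to the walls, the two with bound pi/2 to the glued
  faces.\<close>

definition domain_ineqs :: "((real^3) \<times> real) set" where
  "domain_ineqs = {(vector [0, 0, - 1], 0), (vector [0, - 1, 1], 0), (vector [- 1, 1, 0], 0),
     (vector [0, 1, 0], pi / 2), (vector [1, 0, - 1], pi / 2)}"

lemma domain_AB_halfspaces: "domain_AB = halfspaces_Int domain_ineqs"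
  by (auto simp: domain_AB_iff halfspaces_Int_def domain_ineqs_def inner_vector_3)

lemma finite_domain_ineqs: "finite domain_ineqs"
  by (simp add: domain_ineqs_def)

lemma domain_ineqs_nonzero: "(a, b) \<in> domain_ineqs \<Longrightarrow> a \<noteq> 0"
  by (auto simp: domain_ineqs_def vec_eq_iff forall_3)

lemma convex_domain_AB: "convex domain_AB"
  unfolding domain_AB_halfspaces by (rule convex_halfspaces_Int)

lemma interior_domain_AB:
  "x \<in> interior domain_AB \<longleftrightarrow> 0 < x $ 3 \<and> x $ 3 < x $ 2 \<and> x $ 2 < x $ 1 \<and> x $ 2 < pi / 2 \<and>
     x $ 1 < x $ 3 + pi / 2"
proof -
  have "interior domain_AB = {x. \<forall>(a, b)\<in>domain_ineqs. a \<bullet> x < b}"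
    unfolding domain_AB_halfspaces
    using finite_domain_ineqs domain_ineqs_nonzero by (rule interior_halfspaces_Int)
  then show ?thesis
    by (simp only:) (simp add: domain_ineqs_def inner_vector_3, argo)
qed

lemma interior_domain_AB_nonempty: "interior domain_AB \<noteq> {}"
proof -
  have "vector [1, 3/4, 1/2] \<in> interior domain_AB"
    using pi_gt3 by (simp add: interior_domain_AB)
  then show ?thesis by blast
qed

lemma facet_of_domain_AB:
  "F facet_of domain_AB \<longleftrightarrow> F \<in> {domain_AB \<inter> {x. x $ 3 = 0}, domain_AB \<inter> {x. x $ 2 = x $ 3},
     domain_AB \<inter> {x. x $ 1 = x $ 2}, domain_AB \<inter> {x. x $ 2 = pi / 2},
     domain_AB \<inter> {x. x $ 1 = x $ 3 + pi / 2}}"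
proof -
  have violate: "\<exists>p. b < a \<bullet> p \<and> (\<forall>(a', b')\<in>domain_ineqs. (a', b') \<noteq> (a, b) \<longrightarrow> a' \<bullet> p \<le> b')"
    if "b < a \<bullet> p" "\<forall>(a', b')\<in>domain_ineqs - {(a, b)}. a' \<bullet> p \<le> b'" for a b p
    using that by blast
  have "F facet_of halfspaces_Int domain_ineqs \<longleftrightarrow>
      (\<exists>(a, b)\<in>domain_ineqs. F = halfspaces_Int domain_ineqs \<inter> {x. a \<bullet> x = b})"
  proof (rule facet_of_halfspaces_Int)
    show "finite domain_ineqs" by (rule finite_domain_ineqs)
    show "interior (halfspaces_Int domain_ineqs) \<noteq> {}"
      using interior_domain_AB_nonempty by (simp add: domain_AB_halfspaces)
    show "a \<noteq> 0" if "(a, b) \<in> domain_ineqs" for a b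
      using that by (rule domain_ineqs_nonzero)
    show "\<exists>p. b < a \<bullet> p \<and> (\<forall>(a', b')\<in>domain_ineqs. (a', b') \<noteq> (a, b) \<longrightarrow> a' \<bullet> p \<le> b')"
      if ab: "(a, b) \<in> domain_ineqs" for a b
    proof -
      \<comment> \<open>Each witness below breaks its own inequality only. The values
        \<open>1\<close> and \<open>4\<close> are chosen on either side of pi/2, which the crude
        bounds 3 < pi < 4 certify.\<close>
      consider "(a, b) = (vector [0, 0, - 1], 0)" | "(a, b) = (vector [0, - 1, 1], 0)"
        | "(a, b) = (vector [- 1, 1, 0], 0)" | "(a, b) = (vector [0, 1, 0], pi / 2)"
        | "(a, b) = (vector [1, 0, - 1], pi / 2)"
        using ab unfolding domain_ineqs_def by blast
      then show ?thesis
      proof cases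
        case 1
        then show ?thesis
          using pi_gt3
          by (intro violate[of _ _ "vector [0, 0, - 1]"]) (auto simp: domain_ineqs_def inner_vector_3)
      next
        case 2
        then show ?thesis
          using pi_gt3
          by (intro violate[of _ _ "vector [1, 0, 1]"]) (auto simp: domain_ineqs_def inner_vector_3)
      next
        case 3
        then show ?thesis
          using pi_gt3
          by (intro violate[of _ _ "vector [0, 1, 0]"]) (auto simp: domain_ineqs_def inner_vector_3)
      next
        case 4
        then show ?thesis
          using pi_gt3 pi_less_4
          by (intro violate[of _ _ "vector [4, 4, 4]"]) (auto simp: domain_ineqs_def inner_vector_3)
      next
        case 5
        then show ?thesis
          using pi_gt3 pi_less_4
          by (intro violate[of _ _ "vector [4, 0, 0]"]) (auto simp: domain_ineqs_def inner_vector_3)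
      qed
    qed
  qed
  moreover have "{x. vector [0, 0, - 1] \<bullet> x = 0} = {x :: real^3. x $ 3 = 0}"
    "{x. vector [0, - 1, 1] \<bullet> x = 0} = {x :: real^3. x $ 2 = x $ 3}"
    "{x. vector [- 1, 1, 0] \<bullet> x = 0} = {x :: real^3. x $ 1 = x $ 2}"
    "{x. vector [0, 1, 0] \<bullet> x = pi / 2} = {x :: real^3. x $ 2 = pi / 2}"
    "{x. vector [1, 0, - 1] \<bullet> x = pi / 2} = {x :: real^3. x $ 1 = x $ 3 + pi / 2}"
    by (auto simp: inner_vector_3)
  ultimately show ?thesis
    by (simp only: domain_AB_halfspaces[symmetric]) (simp only: domain_ineqs_def bex_simps
        prod.case insert_iff empty_iff simp_thms)
qed

lemma convex_hyperplane_3: "convex {x :: real^3. a * x $ 1 + b * x $ 2 + c * x $ 3 = d}"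
  using convex_hyperplane[of "vector [a, b, c] :: real^3" d] by (simp add: inner_vector_3)

lemma convex_combination_3:
  fixes a b c :: "'a::real_vector"
  assumes "0 \<le> u" "0 \<le> v" "0 \<le> w" "u + v + w = 1"
  shows "u *\<^sub>R a + v *\<^sub>R b + w *\<^sub>R c \<in> convex hull {a, b, c}"
  using assms unfolding convex_hull_3 by blast

lemma pt_in_domain_AB: "0 \<in> domain_AB" "pt_P \<in> domain_AB" "pt_P' \<in> domain_AB"
    "pt_Q \<in> domain_AB" "pt_Z \<in> domain_AB"
  by (auto simp: domain_AB_iff)

lemma face_P'QZ_eq: "face_P'QZ = domain_AB \<inter> {x. x $ 1 = x $ 3 + pi / 2}"
proof
  have "{x :: real^3. x $ 1 = x $ 3 + pi / 2} = {x. 1 * x $ 1 + 0 * x $ 2 + - 1 * x $ 3 = pi / 2}"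
    by auto
  then have "convex {x :: real^3. x $ 1 = x $ 3 + pi / 2}"
    by (simp only: convex_hyperplane_3)
  then show "face_P'QZ \<subseteq> domain_AB \<inter> {x. x $ 1 = x $ 3 + pi / 2}"
    unfolding face_P'QZ_def using pt_in_domain_AB
    by (intro hull_minimal convex_Int convex_domain_AB) auto
  show "domain_AB \<inter> {x. x $ 1 = x $ 3 + pi / 2} \<subseteq> face_P'QZ"
  proof
    fix x assume x: "x \<in> domain_AB \<inter> {x. x $ 1 = x $ 3 + pi / 2}"
    \<comment> \<open>These are the barycentric coordinates of \<open>simplex_B\<close> on the facet
      where the weight of \<open>pt_P\<close> vanishes.\<close>
    then have "(2 * (x $ 2 - x $ 3) / pi) *\<^sub>R pt_P' + (1 - 2 * x $ 2 / pi) *\<^sub>R pt_Q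
        + (2 * x $ 3 / pi) *\<^sub>R pt_Z \<in> face_P'QZ"
      unfolding face_P'QZ_def
      by (intro convex_combination_3) (auto simp: domain_AB_iff divide_simps algebra_simps)
    also have "(2 * (x $ 2 - x $ 3) / pi) *\<^sub>R pt_P' + (1 - 2 * x $ 2 / pi) *\<^sub>R pt_Q
        + (2 * x $ 3 / pi) *\<^sub>R pt_Z = x"
      using x by (simp add: vec_eq_iff forall_3 field_simps)
    finally show "x \<in> face_P'QZ" .
  qed
qed

lemma face_ZPP'_eq: "face_ZPP' = domain_AB \<inter> {x. x $ 2 = pi / 2}"
proof
  have "{x :: real^3. x $ 2 = pi / 2} = {x. 0 * x $ 1 + 1 * x $ 2 + 0 * x $ 3 = pi / 2}"
    by auto
  then have "convex {x :: real^3. x $ 2 = pi / 2}"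
    by (simp only: convex_hyperplane_3)
  then show "face_ZPP' \<subseteq> domain_AB \<inter> {x. x $ 2 = pi / 2}"
    unfolding face_ZPP'_def using pt_in_domain_AB
    by (intro hull_minimal convex_Int convex_domain_AB) auto
  show "domain_AB \<inter> {x. x $ 2 = pi / 2} \<subseteq> face_ZPP'"
  proof
    fix x assume x: "x \<in> domain_AB \<inter> {x. x $ 2 = pi / 2}"
    then have "(2 * x $ 1 / pi - 1) *\<^sub>R pt_Z + (1 - 2 * (x $ 1 - x $ 3) / pi) *\<^sub>R pt_P
        + (1 - 2 * x $ 3 / pi) *\<^sub>R pt_P' \<in> face_ZPP'"
      unfolding face_ZPP'_def
      by (intro convex_combination_3) (auto simp: domain_AB_iff divide_simps algebra_simps)
    also have "(2 * x $ 1 / pi - 1) *\<^sub>R pt_Z + (1 - 2 * (x $ 1 - x $ 3) / pi) *\<^sub>R pt_P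
        + (1 - 2 * x $ 3 / pi) *\<^sub>R pt_P' = x"
      using x by (simp add: vec_eq_iff forall_3 field_simps)
    finally show "x \<in> face_ZPP'" .
  qed
qed

lemma gamma_map_pts: "gamma_map pt_P' = pt_Z" "gamma_map pt_Q = pt_P" "gamma_map pt_Z = pt_P'"
  by (simp_all add: vec_eq_iff forall_3)

lemma gamma_map_affine:
  assumes "u + v + w = 1"
  shows "gamma_map (u *\<^sub>R a + v *\<^sub>R b + w *\<^sub>R c) =
    u *\<^sub>R gamma_map a + v *\<^sub>R gamma_map b + w *\<^sub>R gamma_map c"
proof -
  have "pi = u * pi + v * pi + w * pi" using assms by (metis distrib_right mult_1)
  then show ?thesis
    by (simp add: vec_eq_iff forall_3) (simp add: algebra_simps)
qed

text \<open>An affine map taking the vertices \<open>pt_P'\<close>, \<open>pt_Q\<close>,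
  \<open>pt_Z\<close> to \<open>pt_Z\<close>, \<open>pt_P\<close>, \<open>pt_P'\<close> preserves
  the weights of convex combinations.\<close>

lemma gamma_map_face: "gamma_map ` face_P'QZ = face_ZPP'"
proof -
  have image: "gamma_map (u *\<^sub>R pt_P' + v *\<^sub>R pt_Q + w *\<^sub>R pt_Z) =
      u *\<^sub>R pt_Z + v *\<^sub>R pt_P + w *\<^sub>R pt_P'" if "u + v + w = 1" for u v w
    using gamma_map_affine[OF that] by (simp add: gamma_map_pts)
  show ?thesis
  proof
    show "gamma_map ` face_P'QZ \<subseteq> face_ZPP'"
      unfolding face_P'QZ_def face_ZPP'_def convex_hull_3 using image by blast
    show "face_ZPP' \<subseteq> gamma_map ` face_P'QZ"
    proof
      fix x assume "x \<in> face_ZPP'"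
      then obtain u v w where x: "x = u *\<^sub>R pt_Z + v *\<^sub>R pt_P + w *\<^sub>R pt_P'"
        and uvw: "0 \<le> u" "0 \<le> v" "0 \<le> w" "u + v + w = 1"
        unfolding face_ZPP'_def convex_hull_3 by blast
      have "x = gamma_map (u *\<^sub>R pt_P' + v *\<^sub>R pt_Q + w *\<^sub>R pt_Z)"
        using image[OF uvw(4)] x by simp
      moreover have "u *\<^sub>R pt_P' + v *\<^sub>R pt_Q + w *\<^sub>R pt_Z \<in> face_P'QZ"
        unfolding face_P'QZ_def using uvw by (rule convex_combination_3)
      ultimately show "x \<in> gamma_map ` face_P'QZ" by blast
    qed
  qed
qed

lemma faces_neq: "face_P'QZ \<noteq> face_ZPP'"
proof -
  have "pt_Q \<in> face_P'QZ" by (simp add: face_P'QZ_def hull_inc)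
  moreover have "pt_Q \<notin> face_ZPP'" by (simp add: face_ZPP'_eq)
  ultimately show ?thesis by metis
qed

section \<open>Walls, mirrors and reflections\<close>

lemma affine_hyperplane_3: "affine {x :: real^3. a * x $ 1 + b * x $ 2 + c * x $ 3 = d}"
  using affine_hyperplane[of "vector [a, b, c] :: real^3" d] by (simp add: inner_vector_3)

lemma zero_notin_affine_faces: "0 \<notin> affine hull face_P'QZ" "0 \<notin> affine hull face_ZPP'"
proof -
  have "affine hull face_P'QZ \<subseteq> {x. 1 * x $ 1 + 0 * x $ 2 + - 1 * x $ 3 = pi / 2}"
    by (intro hull_minimal affine_hyperplane_3) (auto simp: face_P'QZ_eq)
  then show "0 \<notin> affine hull face_P'QZ" by auto
  have "affine hull face_ZPP' \<subseteq> {x. 0 * x $ 1 + 1 * x $ 2 + 0 * x $ 3 = pi / 2}"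
    by (intro hull_minimal affine_hyperplane_3) (auto simp: face_ZPP'_eq)
  then show "0 \<notin> affine hull face_ZPP'" by auto
qed

lemma walls_eq: "walls = {domain_AB \<inter> {x. x $ 3 = 0}, domain_AB \<inter> {x. x $ 2 = x $ 3},
    domain_AB \<inter> {x. x $ 1 = x $ 2}}"
proof -
  have "0 \<in> affine hull (domain_AB \<inter> {x. x $ 3 = 0})" "0 \<in> affine hull (domain_AB \<inter> {x. x $ 2 = x $ 3})"
    "0 \<in> affine hull (domain_AB \<inter> {x. x $ 1 = x $ 2})"
    using pt_in_domain_AB(1) by (auto intro!: hull_inc)
  then show ?thesis
    using zero_notin_affine_faces
    unfolding walls_def facet_of_domain_AB face_P'QZ_eq[symmetric] face_ZPP'_eq[symmetric]
    by auto
qed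

lemma faces_notin_walls: "face_P'QZ \<notin> walls" "face_ZPP' \<notin> walls"
  using zero_notin_affine_faces by (auto simp: walls_def)

lemma facets_eq: "{F. F facet_of domain_AB} = {face_P'QZ, face_ZPP'} \<union> walls"
  by (auto simp: facet_of_domain_AB walls_eq face_P'QZ_eq face_ZPP'_eq)

text \<open>A wall contains the origin, so its affine hull is a linear span, and the two other
  vertices of the wall already generate the plane.\<close>

lemma affine_hull_eq_span2:
  assumes "0 \<in> F" "F \<subseteq> H" "subspace H" "p \<in> F" "q \<in> F"
    and "\<And>x. x \<in> H \<Longrightarrow> \<exists>u v. x = u *\<^sub>R p + v *\<^sub>R q"
  shows "affine hull F = H"
proof -
  have "affine hull F = span F" using assms(1) by (simp add: affine_hull_span_0 hull_inc)
  moreover have "span F \<subseteq> H" using assms by (simp add: span_minimal)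
  moreover have "H \<subseteq> span F"
    using assms by (metis span_add span_base span_scale subsetI)
  ultimately show ?thesis by blast
qed

lemma subspace_lift_eq: "subspace {x. lift x i = lift x j}"
proof (rule subspaceI)
  have scale: "lift (c *\<^sub>R x) k = c * lift x k" for c x k
    by (cases k rule: index_4_cases) simp_all
  show "0 \<in> {x. lift x i = lift x j}" using scale[of 0 0] by auto
  show "c *\<^sub>R x \<in> {x. lift x i = lift x j}" if "x \<in> {x. lift x i = lift x j}" for c x
    using that by (simp add: scale)
qed (simp add: lift_add)

text \<open>In terms of \<open>lift\<close> each plane is the mirror of a transposition: two letters
  coincide. The wall with vanishing third coordinate involves the base point, letter
  \<open>1\<close>.\<close>

lemma affine_hull_walls:
  "affine hull (domain_AB \<inter> {x. x $ 3 = 0}) = {x. lift x 4 = lift x 1}"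
  "affine hull (domain_AB \<inter> {x. x $ 2 = x $ 3}) = {x. lift x 3 = lift x 4}"
  "affine hull (domain_AB \<inter> {x. x $ 1 = x $ 2}) = {x. lift x 2 = lift x 3}"
proof -
  show "affine hull (domain_AB \<inter> {x. x $ 3 = 0}) = {x. lift x 4 = lift x 1}"
  proof (rule affine_hull_eq_span2[where p = pt_Q and q = pt_P'])
    show "\<exists>u v. x = u *\<^sub>R pt_Q + v *\<^sub>R pt_P'" if "x \<in> {x. lift x 4 = lift x 1}" for x
      using that
      by (intro exI[of _ "2 * (x $ 1 - x $ 2) / pi"] exI[of _ "2 * x $ 2 / pi"])
        (simp add: vec_eq_iff forall_3 field_simps)
    show "subspace {x. lift x 4 = lift x 1}" by (rule subspace_lift_eq)
  qed (use pt_in_domain_AB in auto)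
  show "affine hull (domain_AB \<inter> {x. x $ 2 = x $ 3}) = {x. lift x 3 = lift x 4}"
  proof (rule affine_hull_eq_span2[where p = pt_Q and q = pt_P])
    show "\<exists>u v. x = u *\<^sub>R pt_Q + v *\<^sub>R pt_P" if "x \<in> {x. lift x 3 = lift x 4}" for x
      using that
      by (intro exI[of _ "2 * (x $ 1 - x $ 2) / pi"] exI[of _ "2 * x $ 2 / pi"])
        (simp add: vec_eq_iff forall_3 field_simps)
    show "subspace {x. lift x 3 = lift x 4}" by (rule subspace_lift_eq)
  qed (use pt_in_domain_AB in auto)
  show "affine hull (domain_AB \<inter> {x. x $ 1 = x $ 2}) = {x. lift x 2 = lift x 3}"
  proof (rule affine_hull_eq_span2[where p = pt_P' and q = pt_P])
    show "\<exists>u v. x = u *\<^sub>R pt_P' + v *\<^sub>R pt_P" if "x \<in> {x. lift x 2 = lift x 3}" for x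
      using that
      by (intro exI[of _ "2 * (x $ 2 - x $ 3) / pi"] exI[of _ "2 * x $ 3 / pi"])
        (simp add: vec_eq_iff forall_3 field_simps)
    show "subspace {x. lift x 2 = lift x 3}" by (rule subspace_lift_eq)
  qed (use pt_in_domain_AB in auto)
qed

lemma weyl_transpose_fixed:
  "weyl (Transposition.transpose i j) x = x \<longleftrightarrow> lift x i = lift x j"
proof -
  have "weyl (Transposition.transpose i j) x = x \<longleftrightarrow>
      (\<forall>k. lift x (Transposition.transpose i j k) - lift x (Transposition.transpose i j 1) = lift x k)"
    by (simp flip: lift_eq_iff add: fun_eq_iff lift_weyl)
  also have "\<dots> \<longleftrightarrow> lift x i = lift x j"
  proof
    assume *: "\<forall>k. lift x (Transposition.transpose i j k) - lift x (Transposition.transpose i j 1) = lift x k"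
    from *[THEN spec, of i] *[THEN spec, of j] show "lift x i = lift x j" by simp
  next
    assume eq: "lift x i = lift x j"
    have "lift x (Transposition.transpose i j k) = lift x k" for k
      using eq by (simp add: Transposition.transpose_def)
    then show "\<forall>k. lift x (Transposition.transpose i j k) - lift x (Transposition.transpose i j 1) = lift x k"
      by simp
  qed
  finally show ?thesis .
qed

text \<open>A point lying on no other reflection hyperplane determines the reflection.\<close>

lemma wall_reflection_iff:
  assumes hull: "affine hull F = {x. lift x i = lift x j}" and "i \<noteq> j"
    and q: "\<And>k l. lift q k = lift q l \<longleftrightarrow> k = l \<or> {k, l} = {i, j}"
  shows "wall_reflection F s \<longleftrightarrow> s = weyl (Transposition.transpose i j)"
proof
  assume "s = weyl (Transposition.transpose i j)"
  then show "wall_reflection F s"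
    unfolding wall_reflection_def hull
    using weyl_in_W[OF permutes_swap_id[of i UNIV j]] by (auto simp: weyl_transpose_fixed weyl_compose)
next
  assume s: "wall_reflection F s"
  then obtain \<sigma> where \<sigma>: "\<sigma> permutes UNIV" "s = weyl \<sigma>"
    by (auto simp: wall_reflection_def W_eq)
  have fixed: "weyl \<sigma> x = x \<longleftrightarrow> lift x i = lift x j" for x
    using s unfolding wall_reflection_def hull \<sigma>(2) by blast
  have "weyl \<sigma> q = q" using fixed[of q] q[of i j] by simp
  then have eq: "lift q (\<sigma> k) - lift q (\<sigma> 1) = lift q k" for k
    by (metis lift_weyl)
  \<comment> \<open>Summing over all letters kills the permutation and isolates the translation
    part, which must therefore vanish.\<close>
  have "(\<Sum>k\<in>UNIV. lift q (\<sigma> k)) = (\<Sum>k\<in>UNIV. lift q k)"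
    by (rule sum.reindex_bij_betw[OF permutes_imp_bij[OF \<sigma>(1)]])
  moreover have "(\<Sum>k\<in>UNIV. lift q (\<sigma> k)) - (\<Sum>k::4\<in>UNIV. lift q (\<sigma> 1)) = (\<Sum>k\<in>UNIV. lift q k)"
    by (simp only: sum_subtractf[symmetric] eq)
  ultimately have "(\<Sum>k::4\<in>UNIV. lift q (\<sigma> 1)) = 0" by linarith
  then have "lift q (\<sigma> 1) = 0" by simp
  then have \<sigma>_cases: "\<sigma> k = k \<or> {\<sigma> k, k} = {i, j}" for k
    using eq[of k] q[of "\<sigma> k" k] by simp
  have "\<sigma> \<noteq> id"
  proof
    assume "\<sigma> = id"
    \<comment> \<open>This point has four distinct entries and lies on no mirror, whereas the
      identity would fix it.\<close>
    moreover have "lift (vector [1, 2, 3]) i \<noteq> lift (vector [1, 2, 3]) j"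
      using \<open>i \<noteq> j\<close> by (cases i rule: index_4_cases; cases j rule: index_4_cases) auto
    ultimately show False using fixed[of "vector [1, 2, 3]"] by simp
  qed
  then obtain k where "\<sigma> k \<noteq> k" by (auto simp: fun_eq_iff)
  have inj: "\<sigma> k = \<sigma> l \<Longrightarrow> k = l" for k l
    using permutes_inj[OF \<sigma>(1)] by (rule injD)
  have \<sigma>_other: "\<sigma> k = k" if "k \<noteq> i" "k \<noteq> j" for k
    using \<sigma>_cases[of k] that by (auto simp: doubleton_eq_iff)
  have "\<sigma> i = j \<and> \<sigma> j = i"
    using \<sigma>_cases[of k] \<open>\<sigma> k \<noteq> k\<close> \<sigma>_cases[of i] \<sigma>_cases[of j] inj[of i j] \<open>i \<noteq> j\<close>
    by (auto simp: doubleton_eq_iff)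
  then have "\<sigma> = Transposition.transpose i j"
    using \<sigma>_other by (intro ext) (simp add: Transposition.transpose_def)
  then show "s = weyl (Transposition.transpose i j)" using \<sigma>(2) by simp
qed

text \<open>The transposition reverses the sign of the difference of the two entries, while the
  polyhedron lies on one side of the mirror; only points with equal entries survive.\<close>

lemma weyl_transpose_domain_AB:
  assumes "\<And>x. x \<in> domain_AB \<Longrightarrow> lift x j \<le> lift x i"
  shows "weyl (Transposition.transpose i j) ` domain_AB \<inter> domain_AB =
    domain_AB \<inter> {x. lift x i = lift x j}"
proof
  show "weyl (Transposition.transpose i j) ` domain_AB \<inter> domain_AB \<subseteq>
      domain_AB \<inter> {x. lift x i = lift x j}"
  proof
    fix y assume "y \<in> weyl (Transposition.transpose i j) ` domain_AB \<inter> domain_AB"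
    then obtain x where x: "x \<in> domain_AB" "y \<in> domain_AB"
      and y: "y = weyl (Transposition.transpose i j) x" by blast
    show "y \<in> domain_AB \<inter> {x. lift x i = lift x j}"
      using assms[OF x(1)] assms[OF x(2)] x(2) by (simp add: y lift_weyl)
  qed
  show "domain_AB \<inter> {x. lift x i = lift x j} \<subseteq>
      weyl (Transposition.transpose i j) ` domain_AB \<inter> domain_AB"
  proof
    fix x assume x: "x \<in> domain_AB \<inter> {x. lift x i = lift x j}"
    then have "weyl (Transposition.transpose i j) x = x" by (simp add: weyl_transpose_fixed)
    then show "x \<in> weyl (Transposition.transpose i j) ` domain_AB \<inter> domain_AB"
      using x by (metis IntD1 IntI imageI)
  qed
qed

lemma walls_reflection:
  assumes "F \<in> walls"
  shows "(\<exists>!s. wall_reflection F s) \<and>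
    (\<forall>s. wall_reflection F s \<longrightarrow> s ` domain_AB \<inter> domain_AB = F)"
proof -
  have "\<exists>i j. i \<noteq> j \<and> affine hull F = {x. lift x i = lift x j} \<and> F = domain_AB \<inter> {x. lift x i = lift x j} \<and>
      (\<forall>x\<in>domain_AB. lift x j \<le> lift x i) \<and>
      (\<exists>q. \<forall>k l. lift q k = lift q l \<longleftrightarrow> k = l \<or> {k, l} = {i, j})"
  proof -
    consider "F = domain_AB \<inter> {x. x $ 3 = 0}" | "F = domain_AB \<inter> {x. x $ 2 = x $ 3}"
      | "F = domain_AB \<inter> {x. x $ 1 = x $ 2}"
      using assms unfolding walls_eq by blast
    then show ?thesis
    proof cases
      \<comment> \<open>In each case \<open>q\<close> lists four entries, the base point included,
        with exactly one coincidence: it is a generic point of the mirror.\<close>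
      case 1
      then show ?thesis
        by (intro exI[of _ 4] exI[of _ 1] conjI exI[of _ "vector [2, 1, 0]"])
          (auto simp: affine_hull_walls forall_4 domain_AB_iff doubleton_eq_iff)
    next
      case 2
      then show ?thesis
        by (intro exI[of _ 3] exI[of _ 4] conjI exI[of _ "vector [2, 1, 1]"])
          (auto simp: affine_hull_walls forall_4 domain_AB_iff doubleton_eq_iff)
    next
      case 3
      then show ?thesis
        by (intro exI[of _ 2] exI[of _ 3] conjI exI[of _ "vector [2, 2, 1]"])
          (auto simp: affine_hull_walls forall_4 domain_AB_iff doubleton_eq_iff)
    qed
  qed
  then obtain i j q where "i \<noteq> j" "affine hull F = {x. lift x i = lift x j}"
    and F: "F = domain_AB \<inter> {x. lift x i = lift x j}" "\<And>x. x \<in> domain_AB \<Longrightarrow> lift x j \<le> lift x i"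
    and "\<And>k l. lift q k = lift q l \<longleftrightarrow> k = l \<or> {k, l} = {i, j}"
    by blast
  then have "wall_reflection F s \<longleftrightarrow> s = weyl (Transposition.transpose i j)" for s
    by (intro wall_reflection_iff)
  then show ?thesis using weyl_transpose_domain_AB[OF F(2)] F(1) by auto
qed

section \<open>The fundamental domain in the torus\<close>

lemma quotient_map_quotient_topology:
  "quotient_map X (quotient_topology X R) (\<lambda>x. R `` {x})"
  unfolding quotient_map_def topspace_quotient_topology openin_quotient_topology
  by (auto simp: quotient_def)

lemma Gamma_add: "s \<in> Gamma \<Longrightarrow> t \<in> Gamma \<Longrightarrow> s + t \<in> Gamma"
  unfolding Gamma_def
proof (clarsimp)
  fix i assume "\<forall>i. \<exists>k::int. s $ i = pi * of_int k" "\<forall>i. \<exists>k::int. t $ i = pi * of_int k"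
  then obtain k l :: int where "s $ i = pi * of_int k" "t $ i = pi * of_int l" by blast
  then have "s $ i + t $ i = pi * of_int (k + l)" by (simp add: algebra_simps)
  then show "\<exists>k::int. s $ i + t $ i = pi * of_int k" by blast
qed

lemma Gamma_uminus: "t \<in> Gamma \<Longrightarrow> - t \<in> Gamma"
  unfolding Gamma_def
proof (clarsimp)
  fix i assume "\<forall>i. \<exists>k::int. t $ i = pi * of_int k"
  then obtain k :: int where "t $ i = pi * of_int k" by blast
  then have "- t $ i = pi * of_int (- k)" by simp
  then show "\<exists>k::int. - t $ i = pi * of_int k" by blast
qed

lemma Gamma_diff: "s \<in> Gamma \<Longrightarrow> t \<in> Gamma \<Longrightarrow> s - t \<in> Gamma"
  using Gamma_add[of s "- t"] Gamma_uminus by simp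

lemma torus_proj_mem: "y \<in> torus_proj x \<longleftrightarrow> y - x \<in> Gamma"
  by (simp add: torus_proj_def torus_rel_def)

lemma torus_proj_eq_iff: "torus_proj x = torus_proj y \<longleftrightarrow> y - x \<in> Gamma"
proof
  have "y \<in> torus_proj y" by (simp add: torus_proj_mem zero_in_Gamma)
  then show "torus_proj x = torus_proj y \<Longrightarrow> y - x \<in> Gamma"
    by (simp flip: torus_proj_mem)
next
  assume t: "y - x \<in> Gamma"
  have "z - x \<in> Gamma \<longleftrightarrow> z - y \<in> Gamma" for z
    using Gamma_add[OF _ t, of "z - y"] Gamma_diff[OF _ t, of "z - x"] by auto
  then show "torus_proj x = torus_proj y" by (auto simp: torus_proj_mem)
qed

lemma topspace_torus: "topspace torus = range torus_proj"
  by (auto simp: torus_def topspace_quotient_topology quotient_def torus_proj_def)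

lemma quotient_map_torus_proj: "quotient_map euclidean torus torus_proj"
  unfolding torus_def torus_proj_def[abs_def] by (rule quotient_map_quotient_topology)

lemma openin_torus: "openin torus U \<longleftrightarrow> U \<subseteq> range torus_proj \<and> open {x. torus_proj x \<in> U}"
proof -
  have "open {x. torus_proj x \<in> U} = openin torus U" if "U \<subseteq> range torus_proj"
    using quotient_map_torus_proj that unfolding quotient_map_def topspace_torus by simp
  moreover have "U \<subseteq> range torus_proj" if "openin torus U"
    using openin_subset[OF that] by (simp add: topspace_torus)
  ultimately show ?thesis by blast
qed

lemma closedin_torus:
  "closedin torus U \<longleftrightarrow> U \<subseteq> range torus_proj \<and> closed {x. torus_proj x \<in> U}"
proof -
  have "closed {x. torus_proj x \<in> U} = closedin torus U" if "U \<subseteq> range torus_proj"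
    using quotient_map_torus_proj that unfolding quotient_map_closedin topspace_torus by simp
  moreover have "U \<subseteq> range torus_proj" if "closedin torus U"
    using closedin_subset[OF that] by (simp add: topspace_torus)
  ultimately show ?thesis by blast
qed

lemma torus_proj_preimage_image:
  "{x. torus_proj x \<in> torus_proj ` S} = (\<Union>t\<in>Gamma. \<Union>y\<in>S. {t + y})"
proof (intro Set.set_eqI iffI)
  fix x assume "x \<in> {x. torus_proj x \<in> torus_proj ` S}"
  then obtain y where y: "y \<in> S" "x - y \<in> Gamma"
    by (auto simp: torus_proj_eq_iff[symmetric] eq_commute)
  then have "x = (x - y) + y" by simp
  then show "x \<in> (\<Union>t\<in>Gamma. \<Union>y\<in>S. {t + y})" using y by blast
next
  fix x assume "x \<in> (\<Union>t\<in>Gamma. \<Union>y\<in>S. {t + y})"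
  then obtain t y where "t \<in> Gamma" "y \<in> S" "x = t + y" by blast
  then have "torus_proj y = torus_proj x" by (simp add: torus_proj_eq_iff)
  then show "x \<in> {x. torus_proj x \<in> torus_proj ` S}" using \<open>y \<in> S\<close> by auto
qed

text \<open>The saturation of an open set is a union of translates, hence open.\<close>

lemma openin_torus_image: "open S \<Longrightarrow> openin torus (torus_proj ` S)"
proof -
  assume S: "open S"
  have "(\<Union>t\<in>Gamma. \<Union>y\<in>S. {t + y}) = (\<Union>t\<in>Gamma. (+) t ` S)" by auto
  then have "open (\<Union>t\<in>Gamma. \<Union>y\<in>S. {t + y})"
    using S by (auto intro!: open_translation)
  then show ?thesis unfolding openin_torus torus_proj_preimage_image by blast
qed

lemma Gamma_eq_Ints: "t \<in> Gamma \<longleftrightarrow> (\<forall>i. t $ i / pi \<in> \<int>)"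
proof -
  have "(\<exists>k::int. a = pi * of_int k) \<longleftrightarrow> a / pi \<in> \<int>" for a
    unfolding Ints_def image_iff by (simp add: field_simps)
  then show ?thesis by (simp add: Gamma_def)
qed

lemma closed_Gamma: "closed Gamma"
proof -
  have "Gamma = (\<Inter>i. (\<lambda>t. t $ i / pi) -` \<int>)" by (auto simp: Gamma_eq_Ints)
  also have "closed \<dots>"
    by (intro closed_INT ballI closed_vimage closed_Ints continuous_intros) auto
  finally show ?thesis .
qed

lemma Gamma_component_zero:
  assumes "t \<in> Gamma" "\<bar>t $ i\<bar> < pi"
  shows "t $ i = 0"
proof -
  obtain k :: int where k: "t $ i = pi * of_int k" using assms(1) by (auto simp: Gamma_def)
  then have "\<bar>of_int k :: real\<bar> < 1" using assms(2) by (simp add: abs_mult)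
  then have "k = 0" by linarith
  then show ?thesis by (simp add: k)
qed

text \<open>Nonzero lattice vectors have norm at least pi, so removing the origin amounts to a
  closed norm condition; the threshold \<open>1\<close> is any positive number below pi.\<close>

lemma closed_Gamma_minus_zero: "closed (Gamma - {0})"
proof -
  have "Gamma - {0} = Gamma \<inter> {t. 1 \<le> norm t}"
  proof (intro Set.set_eqI iffI)
    fix t assume t: "t \<in> Gamma - {0}"
    then obtain i where "t $ i \<noteq> 0" by (auto simp: vec_eq_iff)
    then have "pi \<le> \<bar>t $ i\<bar>" using Gamma_component_zero t by (metis DiffD1 not_le)
    then have "1 \<le> norm t" using component_le_norm_cart[of t i] pi_gt3 by linarith
    then show "t \<in> Gamma \<inter> {t. 1 \<le> norm t}" using t by simp
  qed auto
  moreover have "closed {t :: real^3. 1 \<le> norm t}"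
    by (intro closed_Collect_le continuous_intros)
  ultimately show ?thesis using closed_Gamma by auto
qed

lemma compact_domain_AB: "compact domain_AB"
  unfolding domain_AB_def using simplex_A simplex_B by (intro compact_Un compact_simplex)

text \<open>The second and third coordinates vary by at most pi/2. The first can vary by pi, as
  between \<open>0\<close> and \<open>pt_Z\<close>, but only by pi/2 once the third coordinates
  agree.\<close>

lemma inj_on_torus_proj: "inj_on torus_proj domain_AB"
proof (rule inj_onI)
  fix x y assume x: "x \<in> domain_AB" and y: "y \<in> domain_AB" and "torus_proj x = torus_proj y"
  then have t: "y - x \<in> Gamma" by (simp add: torus_proj_eq_iff)
  have "\<bar>(y - x) $ 2\<bar> < pi" "\<bar>(y - x) $ 3\<bar> < pi"
    using x y pi_gt_zero unfolding domain_AB_iff vector_minus_component abs_less_iff by linarith+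
  then have 23: "(y - x) $ 2 = 0" "(y - x) $ 3 = 0"
    using Gamma_component_zero[OF t] by blast+
  have "\<bar>(y - x) $ 1\<bar> < pi"
    using x y pi_gt_zero 23 unfolding domain_AB_iff vector_minus_component abs_less_iff by linarith
  then have "(y - x) $ 1 = 0"
    by (rule Gamma_component_zero[OF t])
  then show "x = y" using 23 by (simp add: vec_eq_iff forall_3)
qed

text \<open>Since the translates of the polyhedron by nonzero lattice vectors form a closed set
  disjoint from it, passing to the torus creates no new interior points.\<close>

lemma interior_of_torus_domain_AB:
  "torus interior_of (torus_proj ` domain_AB) = torus_proj ` interior domain_AB"
proof
  show "torus_proj ` interior domain_AB \<subseteq> torus interior_of (torus_proj ` domain_AB)"
    by (intro interior_of_maximal openin_torus_image image_mono interior_subset open_interior)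
  define K where "K = (\<Union>t\<in>Gamma - {0}. \<Union>y\<in>domain_AB. {t + y})"
  have K: "closed K"
    unfolding K_def using closed_Gamma_minus_zero compact_domain_AB by (rule closed_compact_sums)
  have disj: "K \<inter> domain_AB = {}"
  proof -
    have False if "t \<in> Gamma - {0}" "y \<in> domain_AB" "t + y \<in> domain_AB" for t y
    proof -
      have "torus_proj y = torus_proj (t + y)" using that by (simp add: torus_proj_eq_iff)
      then have "y = t + y" using inj_onD[OF inj_on_torus_proj] that by blast
      then show False using that by simp
    qed
    then show ?thesis by (auto simp: K_def)
  qed
  show "torus interior_of (torus_proj ` domain_AB) \<subseteq> torus_proj ` interior domain_AB"
  proof
    fix c assume c: "c \<in> torus interior_of (torus_proj ` domain_AB)"
    then obtain x where x: "x \<in> domain_AB" "c = torus_proj x"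
      using interior_of_subset[of torus "torus_proj ` domain_AB"] by blast
    \<comment> \<open>Outside \<open>K\<close> a lattice translate of a point of the polyhedron must
      be the trivial one, so this neighbourhood of \<open>x\<close> lies in the polyhedron.\<close>
    define V where "V = {x. torus_proj x \<in> torus interior_of (torus_proj ` domain_AB)} \<inter> - K"
    have "open {x. torus_proj x \<in> torus interior_of (torus_proj ` domain_AB)}"
      using openin_interior_of openin_torus by blast
    then have "open V" unfolding V_def using K by (intro open_Int open_Compl)
    moreover have "x \<in> V" using x c disj by (auto simp: V_def)
    moreover have "V \<subseteq> domain_AB"
    proof
      fix z assume z: "z \<in> V"
      then have "z \<in> {x. torus_proj x \<in> torus_proj ` domain_AB}"
        using interior_of_subset[of torus "torus_proj ` domain_AB"] by (auto simp: V_def)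
      then obtain t y where t: "t \<in> Gamma" "y \<in> domain_AB" "z = t + y"
        unfolding torus_proj_preimage_image by blast
      then have "t = 0" using z by (auto simp: V_def K_def)
      then show "z \<in> domain_AB" using t by simp
    qed
    ultimately have "x \<in> interior domain_AB" by (meson interior_maximal subsetD)
    then show "c \<in> torus_proj ` interior domain_AB" using x by blast
  qed
qed

text \<open>The saturation is the sum of a closed and a compact set, hence closed. Density of the
  interior comes from convexity upstairs and passes through the continuous projection.\<close>

lemma closure_of_torus_domain_AB:
  "torus closure_of (torus_proj ` interior domain_AB) = torus_proj ` domain_AB"
proof
  have "closedin torus (torus_proj ` domain_AB)"
    unfolding closedin_torus torus_proj_preimage_image
    using closed_compact_sums[OF closed_Gamma compact_domain_AB] by blast
  then show "torus closure_of (torus_proj ` interior domain_AB) \<subseteq> torus_proj ` domain_AB"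
    by (intro closure_of_minimal image_mono interior_subset)
  have "closure (interior domain_AB) = domain_AB"
    using convex_closure_interior[OF convex_domain_AB interior_domain_AB_nonempty]
      compact_imp_closed[OF compact_domain_AB] by simp
  moreover have "torus_proj ` (euclidean closure_of (interior domain_AB)) \<subseteq>
      torus closure_of (torus_proj ` interior domain_AB)"
    by (intro continuous_map_image_closure_subset quotient_imp_continuous_map quotient_map_torus_proj)
  ultimately show "torus_proj ` domain_AB \<subseteq> torus closure_of (torus_proj ` interior domain_AB)"
    by simp
qed

section \<open>The action of \<open>W\<close> on the torus and its translates of the
  polyhedron\<close>

lemma lift_diff: "lift (x - y) i = lift x i - lift y i"
  by (cases i rule: index_4_cases) simp_all

lemma weyl_diff: "weyl \<sigma> (x - y) = weyl \<sigma> x - weyl \<sigma> y"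
  by (simp add: weyl_def vec_eq_iff forall_3 lift_diff)

lemma weyl_Gamma:
  assumes "t \<in> Gamma"
  shows "weyl \<sigma> t \<in> Gamma"
proof -
  have "\<exists>k::int. weyl \<sigma> t $ i = pi * of_int k" for i
  proof -
    obtain k l :: int where "lift t (\<sigma> (suc_index i)) = pi * of_int k" "lift t (\<sigma> 1) = pi * of_int l"
      using lift_Gamma[OF assms] by meson
    then have "weyl \<sigma> t $ i = pi * of_int (k - l)"
      by (simp add: lift_suc_index[symmetric] lift_weyl algebra_simps del: lift_suc_index)
    then show ?thesis by blast
  qed
  then show ?thesis by (simp add: Gamma_def)
qed

lemma weyl_image_torus_proj:
  assumes "\<sigma> permutes UNIV"
  shows "weyl \<sigma> ` torus_proj x = torus_proj (weyl \<sigma> x)"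
proof
  show "weyl \<sigma> ` torus_proj x \<subseteq> torus_proj (weyl \<sigma> x)"
    by (auto simp: torus_proj_mem weyl_diff[symmetric] intro: weyl_Gamma)
  show "torus_proj (weyl \<sigma> x) \<subseteq> weyl \<sigma> ` torus_proj x"
  proof
    fix z assume "z \<in> torus_proj (weyl \<sigma> x)"
    then have "weyl (inv_into UNIV \<sigma>) (z - weyl \<sigma> x) \<in> Gamma"
      by (intro weyl_Gamma) (simp add: torus_proj_mem)
    then have "weyl (inv_into UNIV \<sigma>) z \<in> torus_proj x"
      using weyl_inv[OF assms] by (simp add: torus_proj_mem weyl_diff fun_eq_iff)
    moreover have "z = weyl \<sigma> (weyl (inv_into UNIV \<sigma>) z)"
      using weyl_inv[OF assms] by (simp add: fun_eq_iff)
    ultimately show "z \<in> weyl \<sigma> ` torus_proj x" by blast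
  qed
qed

text \<open>Undoing \<open>\<tau>\<close> relates \<open>x\<close> to \<open>y\<close> by the
  relabelling \<open>\<sigma> \<circ> inv_into UNIV \<tau>\<close>, which rigidity at interior
  points makes trivial.\<close>

lemma weyl_translates_disjoint:
  assumes \<sigma>: "\<sigma> permutes UNIV" and \<tau>: "\<tau> permutes UNIV"
    and x: "x \<in> interior domain_AB" and y: "y \<in> interior domain_AB"
    and eq: "torus_proj (weyl \<sigma> x) = torus_proj (weyl \<tau> y)"
  shows "\<sigma> = \<tau>"
proof -
  have t: "weyl \<tau> y - weyl \<sigma> x \<in> Gamma" using eq by (simp add: torus_proj_eq_iff)
  have "\<exists>k::int. lift y j = lift x ((\<sigma> \<circ> inv_into UNIV \<tau>) j) +
      (lift y (\<tau> 1) - lift x (\<sigma> 1)) + pi * of_int k" for j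
    using lift_Gamma[OF t, of "inv_into UNIV \<tau> j"] permutes_inverses(1)[OF \<tau>]
    by (auto simp: lift_diff lift_weyl algebra_simps)
  moreover have "\<sigma> \<circ> inv_into UNIV \<tau> permutes UNIV"
    using \<sigma> \<tau> by (intro permutes_compose permutes_inv)
  moreover have "y \<in> domain_AB" using y interior_subset by blast
  ultimately have "\<sigma> \<circ> inv_into UNIV \<tau> = id"
    using x unfolding interior_domain_AB by (intro domain_AB_rigid) auto
  then have "\<sigma> \<circ> (inv_into UNIV \<tau> \<circ> \<tau>) = \<tau>" by (simp add: o_assoc)
  then show ?thesis using permutes_inv_o(2)[OF \<tau>] by simp
qed

lemma fundamental_domain_AB:
  "fundamental_domain torus W (\<lambda>w c. w ` c) (torus_proj ` domain_AB)"
  unfolding fundamental_domain_def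
proof (intro conjI ballI impI)
  show "torus_proj ` domain_AB \<subseteq> topspace torus" by (auto simp: topspace_torus)
  show "torus closure_of (torus interior_of torus_proj ` domain_AB) = torus_proj ` domain_AB"
    by (simp add: interior_of_torus_domain_AB closure_of_torus_domain_AB)
  show "(\<Union>g\<in>W. (`) g ` torus_proj ` domain_AB) = topspace torus"
  proof
    show "(\<Union>g\<in>W. (`) g ` torus_proj ` domain_AB) \<subseteq> topspace torus"
      by (auto simp: W_eq topspace_torus weyl_image_torus_proj)
    show "topspace torus \<subseteq> (\<Union>g\<in>W. (`) g ` torus_proj ` domain_AB)"
    proof
      fix c assume "c \<in> topspace torus"
      then obtain x where c: "c = torus_proj x" by (auto simp: topspace_torus)
      obtain y where y: "y \<in> domain_AB" "config_equiv y x"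
        using config_equiv_domain_AB config_equiv_sym by blast
      then obtain \<sigma> t where \<sigma>: "\<sigma> permutes UNIV" "t \<in> Gamma" "x = t + weyl \<sigma> y"
        by (auto simp: config_equiv_iff)
      then have "torus_proj (weyl \<sigma> y) = c"
        by (simp add: c torus_proj_eq_iff)
      then have "c = weyl \<sigma> ` torus_proj y" using \<sigma>(1) by (simp add: weyl_image_torus_proj)
      then show "c \<in> (\<Union>g\<in>W. (`) g ` torus_proj ` domain_AB)"
        using weyl_in_W[OF \<sigma>(1)] y(1) by blast
    qed
  qed
  fix g h assume "g \<in> W" "h \<in> W" and ne: "g \<noteq> h"
  then obtain \<sigma> \<tau> where \<sigma>: "g = weyl \<sigma>" "\<sigma> permutes UNIV" and \<tau>: "h = weyl \<tau>" "\<tau> permutes UNIV"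
    by (auto simp: W_eq)
  show "(`) g ` (torus interior_of torus_proj ` domain_AB) \<inter>
      (`) h ` (torus interior_of torus_proj ` domain_AB) = {}"
    using weyl_translates_disjoint[OF \<sigma>(2) \<tau>(2)] ne unfolding interior_of_torus_domain_AB \<sigma>(1) \<tau>(1)
    by (auto simp: weyl_image_torus_proj \<sigma>(2) \<tau>(2)) blast
qed

section \<open>Simultaneous diagonalization of commuting symmetric operators\<close>

text \<open>The maximum of the quadratic form on the unit sphere is attained at an eigenvector.\<close>

lemma symmetric_eigenvector:
  fixes f :: "'a::euclidean_space \<Rightarrow> 'a"
  assumes lin: "linear f" and sym: "\<And>x y. f x \<bullet> y = x \<bullet> f y"
    and S: "subspace S" and ne: "S \<noteq> {0}" and inv: "\<And>x. x \<in> S \<Longrightarrow> f x \<in> S"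
  obtains v l where "v \<in> S" "norm v = 1" "f v = l *\<^sub>R v"
proof -
  have "compact (S \<inter> sphere 0 1)"
    using closed_subspace[OF S] by (simp add: closed_Int_compact)
  moreover have "S \<inter> sphere 0 1 \<noteq> {}"
  proof -
    obtain x where x: "x \<in> S" "x \<noteq> 0" using ne subspace_0[OF S] by blast
    then have "x /\<^sub>R norm x \<in> S \<inter> sphere 0 1" using subspace_scale[OF S] by simp
    then show ?thesis by blast
  qed
  moreover have "continuous_on (S \<inter> sphere 0 1) (\<lambda>x. x \<bullet> f x)"
    using lin by (intro continuous_intros linear_continuous_on) (simp add: linear_conv_bounded_linear)
  ultimately have "\<exists>v\<in>S \<inter> sphere 0 1. \<forall>x\<in>S \<inter> sphere 0 1. x \<bullet> f x \<le> v \<bullet> f v"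
    by (rule continuous_attains_sup)
  then obtain v where v: "v \<in> S \<inter> sphere 0 1"
    and max: "\<And>x. x \<in> S \<inter> sphere 0 1 \<Longrightarrow> x \<bullet> f x \<le> v \<bullet> f v"
    by blast
  define l where "l = v \<bullet> f v"
  have le: "x \<bullet> f x \<le> l * (x \<bullet> x)" if "x \<in> S" for x
  proof (cases "x = 0")
    case False
    then have "x /\<^sub>R norm x \<in> S \<inter> sphere 0 1" using subspace_scale[OF S] that by simp
    from max[OF this] have "(x \<bullet> f x) / (norm x)\<^sup>2 \<le> l"
      by (simp add: l_def linear_scale[OF lin] power2_eq_square divide_inverse mult_ac)
    then show ?thesis using False by (simp add: divide_le_eq power2_norm_eq_inner)
  qed (use linear_0[OF lin] in simp)
  define r where "r = f v - l *\<^sub>R v"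
  have r: "r \<in> S" unfolding r_def using v inv S by (intro subspace_diff subspace_scale) auto
  have vv: "v \<bullet> v = 1" using v by (simp flip: power2_norm_eq_inner)
  define C where "C = l * (r \<bullet> r) - r \<bullet> f r"
  \<comment> \<open>Moving the maximizer in the direction of the residual \<open>r\<close> gains
    \<open>2 * t * (r \<bullet> r)\<close> to first order, which maximality bounds by a second-order
    term.\<close>
  have var: "2 * t * (r \<bullet> r) \<le> t\<^sup>2 * C" for t
  proof -
    have "v + t *\<^sub>R r \<in> S" using v r S by (intro subspace_add subspace_scale) auto
    from le[OF this]
    have "l + 2 * t * (r \<bullet> f v) + t\<^sup>2 * (r \<bullet> f r) \<le> l * (1 + 2 * t * (r \<bullet> v) + t\<^sup>2 * (r \<bullet> r))"
      using sym[of v r] inner_commute[of "f v" r]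
      by (simp add: linear_add[OF lin] linear_scale[OF lin] inner_simps l_def[symmetric] vv
          inner_commute[of v r] power2_eq_square algebra_simps)
    then have "2 * t * (r \<bullet> f v - l * (r \<bullet> v)) \<le> t\<^sup>2 * C"
      unfolding C_def by (simp add: algebra_simps)
    moreover have "r \<bullet> r = r \<bullet> f v - l * (r \<bullet> v)"
      by (simp add: r_def inner_simps)
    ultimately show ?thesis by (simp only:)
  qed
  have "r \<bullet> r = 0"
  proof (rule ccontr)
    assume "r \<bullet> r \<noteq> 0"
    then have pos: "r \<bullet> r > 0" by simp
    \<comment> \<open>Small enough for the second-order term to stay below the first-order gain; the
      added \<open>1\<close> keeps the denominator positive.\<close>
    define t where "t = r \<bullet> r / (\<bar>C\<bar> + 1)"
    have t: "t > 0" using pos by (simp add: t_def)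
    have "2 * (r \<bullet> r) \<le> t * C" using var[of t] t by (simp add: power2_eq_square)
    also have "\<dots> \<le> t * (\<bar>C\<bar> + 1)" using t by (intro mult_left_mono) auto
    also have "\<dots> = r \<bullet> r" by (simp add: t_def)
    finally show False using pos by simp
  qed
  then have "f v = l *\<^sub>R v" by (simp add: r_def)
  then show ?thesis using that v by auto
qed

text \<open>Commutation makes an eigenspace of \<open>f\<close> invariant under \<open>g\<close>, so
  \<open>g\<close> has an eigenvector inside it. By symmetry its orthogonal complement is invariant
  under both, which is why the induction runs over invariant subspaces.\<close>

lemma common_orthonormal_eigenbasis:
  fixes f g :: "'a::euclidean_space \<Rightarrow> 'a"
  assumes f: "linear f" "\<And>x y. f x \<bullet> y = x \<bullet> f y"
    and g: "linear g" "\<And>x y. g x \<bullet> y = x \<bullet> g y"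
    and comm: "\<And>x. f (g x) = g (f x)"
    and S: "subspace S" "\<And>x. x \<in> S \<Longrightarrow> f x \<in> S" "\<And>x. x \<in> S \<Longrightarrow> g x \<in> S"
  shows "\<exists>B. B \<subseteq> S \<and> pairwise orthogonal B \<and> span B = S \<and>
    (\<forall>v\<in>B. norm v = 1 \<and> (\<exists>l. f v = l *\<^sub>R v) \<and> (\<exists>m. g v = m *\<^sub>R v))"
  using S
proof (induction "dim S" arbitrary: S rule: less_induct)
  case (less S)
  show ?case
  proof (cases "S = {0}")
    case True
    then show ?thesis by (intro exI[of _ "{}"]) (simp add: pairwise_empty)
  next
    case False
    obtain v l where v: "v \<in> S" "norm v = 1" "f v = l *\<^sub>R v"
      using symmetric_eigenvector[OF f less.prems(1) False less.prems(2)] by blast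
    define T where "T = {x \<in> S. f x = l *\<^sub>R x}"
    have "subspace T"
      unfolding T_def subspace_def
      using less.prems(1) linear_0[OF f(1)] linear_add[OF f(1)] linear_scale[OF f(1)]
      by (auto simp: subspace_def algebra_simps)
    moreover have "T \<noteq> {0}"
    proof -
      have "v \<in> T" using v by (simp add: T_def)
      moreover have "v \<noteq> 0" using v(2) by auto
      ultimately show ?thesis by blast
    qed
    moreover have "g x \<in> T" if "x \<in> T" for x
      using that less.prems(3) by (auto simp: T_def comm linear_scale[OF g(1)])
    ultimately obtain u m where u: "u \<in> T" "norm u = 1" "g u = m *\<^sub>R u"
      using symmetric_eigenvector[OF g] by blast
    have uS: "u \<in> S" and fu: "f u = l *\<^sub>R u" using u(1) by (auto simp: T_def)
    have uu: "u \<bullet> u = 1" using u(2) by (simp flip: power2_norm_eq_inner)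
    define S' where "S' = {x \<in> S. u \<bullet> x = 0}"
    have S': "subspace S'"
      unfolding S'_def using less.prems(1) by (auto simp: subspace_def inner_simps)
    have "u \<notin> S'" using uu by (simp add: S'_def)
    then have "S' \<subset> S" using uS unfolding S'_def by blast
    then have "dim S' < dim S"
      using S' less.prems(1) by (intro dim_psubset) (simp add: span_eq_iff[THEN iffD2])
    moreover have "f x \<in> S'" if "x \<in> S'" for x
      using that less.prems(2) f(2)[of u x] fu by (simp add: S'_def)
    moreover have "g x \<in> S'" if "x \<in> S'" for x
      using that less.prems(3) g(2)[of u x] u(3) by (simp add: S'_def)
    ultimately obtain B where B: "B \<subseteq> S'" "pairwise orthogonal B" "span B = S'"
      "\<forall>v\<in>B. norm v = 1 \<and> (\<exists>l. f v = l *\<^sub>R v) \<and> (\<exists>m. g v = m *\<^sub>R v)"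
      using less.hyps[of S'] S' by blast
    have "pairwise orthogonal (insert u B)"
      using B(1,2) by (auto simp: pairwise_insert orthogonal_def S'_def inner_commute)
    moreover have "span (insert u B) = S"
    proof
      show "span (insert u B) \<subseteq> S"
        using B(1) uS less.prems(1) by (intro span_minimal) (auto simp: S'_def)
      show "S \<subseteq> span (insert u B)"
      proof
        fix x assume x: "x \<in> S"
        have "x - (u \<bullet> x) *\<^sub>R u \<in> S'"
          using x uS less.prems(1) uu
          by (auto simp: S'_def inner_simps intro: subspace_diff subspace_scale)
        then show "x \<in> span (insert u B)" using B(3) by (auto simp: span_insert)
      qed
    qed
    moreover have "insert u B \<subseteq> S" using B(1) uS by (auto simp: S'_def)
    ultimately show ?thesis using B(4) u(2,3) fu by blast
  qed
qed

text \<open>The eigenvectors are the rows of \<open>V\<close>, to match an action of the form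
  \<open>V \<Lambda> V^t\<close>.\<close>

lemma commuting_symmetric_eigenbasis:
  fixes X Y :: "real^'n^'n"
  assumes X: "transpose X = X" and Y: "transpose Y = Y" and comm: "X ** Y = Y ** X"
  obtains V :: "real^'n^'n" and d e where "orthogonal_matrix V"
    "\<And>i. X *v (V $ i) = d i *\<^sub>R V $ i" "\<And>i. Y *v (V $ i) = e i *\<^sub>R V $ i"
proof -
  have symm: "(A *v x) \<bullet> y = x \<bullet> (A *v y)" if "transpose A = A" for A :: "real^'n^'n" and x y
    using that dot_lmul_matrix[of x A y] transpose_matrix_vector[of A x] by simp
  have "\<exists>B. B \<subseteq> (UNIV :: (real^'n) set) \<and> pairwise orthogonal B \<and> span B = UNIV \<and>
      (\<forall>v\<in>B. norm v = 1 \<and> (\<exists>l. X *v v = l *\<^sub>R v) \<and> (\<exists>m. Y *v v = m *\<^sub>R v))"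
    using symm[OF X] symm[OF Y]
    by (intro common_orthonormal_eigenbasis) (auto simp: matrix_vector_mul_assoc comm)
  then obtain B :: "(real^'n) set" where B: "pairwise orthogonal B" "span B = UNIV"
    "\<And>v. v \<in> B \<Longrightarrow> norm v = 1" "\<And>v. v \<in> B \<Longrightarrow> \<exists>l. X *v v = l *\<^sub>R v"
    "\<And>v. v \<in> B \<Longrightarrow> \<exists>m. Y *v v = m *\<^sub>R v"
    by blast
  have "0 \<notin> B" using B(3) by force
  then have ind: "independent B" using B(1) pairwise_orthogonal_independent by blast
  have "card B = CARD('n)"
    using dim_span_eq_card_independent[OF ind] B(2) by (simp add: dim_UNIV)
  then obtain b where b: "bij_betw b (UNIV :: 'n set) B"
    using finite_same_card_bij[of "UNIV :: 'n set" B] ind independent_imp_finite by auto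
  define V where "V = (\<chi> i. b i)"
  have bB: "b i \<in> B" for i using b by (auto simp: bij_betw_def)
  have binj: "b i = b j \<longleftrightarrow> i = j" for i j using b by (auto simp: bij_betw_def inj_on_def)
  have "orthogonal_matrix V"
    unfolding orthogonal_matrix_orthonormal_rows
    using bB binj B(1,3) by (auto simp: V_def row_def pairwise_def vec_lambda_eta)
  moreover have "\<exists>d. \<forall>i. X *v (V $ i) = d i *\<^sub>R V $ i"
    using bB B(4) by (auto simp: V_def intro!: choice)
  moreover have "\<exists>e. \<forall>i. Y *v (V $ i) = e i *\<^sub>R V $ i"
    using bB B(5) by (auto simp: V_def intro!: choice)
  ultimately show ?thesis using that by blast
qed


section \<open>The moduli relation on diagonal matrices\<close>

definition diag_matrix :: "('n \<Rightarrow> 'a) \<Rightarrow> 'a::zero^'n^'n::finite" where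
  "diag_matrix d = (\<chi> i j. if i = j then d i else 0)"

lemma diag_matrix_nth [simp]: "diag_matrix d $ i $ j = (if i = j then d i else 0)"
  by (simp add: diag_matrix_def)

lemma matrix_mult_nth: "(A ** B) $ i $ j = (\<Sum>k\<in>UNIV. A $ i $ k * B $ k $ j)"
  by (simp add: matrix_matrix_mult_def)

lemma transpose_nth [simp]: "transpose A $ i $ j = A $ j $ i"
  by (simp add: transpose_def)

lemma diag_mult_nth [simp]:
  fixes A :: "'a::comm_semiring_1^'m^'n"
  shows "(diag_matrix d ** A) $ i $ j = d i * A $ i $ j"
  by (simp add: matrix_mult_nth if_distrib if_distribR sum.delta' cong: if_cong)

lemma mult_diag_nth [simp]:
  fixes A :: "'a::comm_semiring_1^'n^'m"
  shows "(A ** diag_matrix d) $ i $ j = A $ i $ j * d j"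
  by (simp add: matrix_mult_nth if_distrib if_distribR sum.delta' cong: if_cong)

definition perm_matrix :: "('n \<Rightarrow> 'n) \<Rightarrow> 'a::semiring_1^'n^'n::finite" where
  "perm_matrix \<sigma> = (\<chi> i j. if j = \<sigma> i then 1 else 0)"

lemma perm_mult_nth [simp]:
  fixes A :: "'a::comm_semiring_1^'m^'n"
  shows "(perm_matrix \<sigma> ** A) $ i $ j = A $ \<sigma> i $ j"
  by (simp add: perm_matrix_def matrix_mult_nth if_distrib if_distribR sum.delta cong: if_cong)

lemma mult_transpose_perm_nth [simp]:
  fixes A :: "'a::comm_semiring_1^'n^'m"
  shows "(A ** transpose (perm_matrix \<sigma>)) $ i $ j = A $ i $ \<sigma> j"
  by (simp add: perm_matrix_def matrix_mult_nth if_distrib if_distribR sum.delta cong: if_cong)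

lemma mat_eq_diag: "mat c = diag_matrix (\<lambda>_. c)"
  by (simp add: vec_eq_iff mat_def)

lemma mat_mult_nth [simp]:
  fixes A :: "'a::comm_semiring_1^'m^'n"
  shows "(mat c ** A) $ i $ j = c * A $ i $ j"
  by (simp add: mat_eq_diag)

lemma diag_phi_eq: "diag_phi x = diag_matrix (\<lambda>i. cis (- 2 * lift x i))"
proof -
  have "(vector [1, cis (- 2 * x $ 1), cis (- 2 * x $ 2), cis (- 2 * x $ 3)] :: complex^4) $ i =
      cis (- 2 * lift x i)" for i
    by (cases i rule: index_4_cases) simp_all
  then show ?thesis by (simp add: diag_phi_def vec_eq_iff)
qed

section \<open>Complexified real matrices and the equivalence relation on symmetric
  unitaries\<close>

abbreviation cmat :: "real^'n^'m \<Rightarrow> complex^'n^'m" where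
  "cmat \<equiv> map_matrix of_real"

lemma cmat_mult: "cmat (A ** B) = cmat A ** cmat B"
  by (simp add: vec_eq_iff matrix_mult_nth)

lemma cmat_transpose: "cmat (transpose A) = transpose (cmat A)"
  by (simp add: vec_eq_iff)

lemma cmat_mat: "cmat (mat c) = mat (of_real c)"
  by (simp add: vec_eq_iff mat_def)

lemma cmat_diag: "cmat (diag_matrix d) = diag_matrix (\<lambda>i. of_real (d i))"
  by (simp add: vec_eq_iff)

lemma cmat_perm: "cmat (perm_matrix \<sigma>) = perm_matrix \<sigma>"
  by (simp add: vec_eq_iff perm_matrix_def)

lemma cmat_orthogonal:
  assumes "orthogonal_matrix V"
  shows "cmat V ** transpose (cmat V) = mat 1" "transpose (cmat V) ** cmat V = mat 1"
  using assms unfolding orthogonal_matrix_def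
  by (metis cmat_mat cmat_mult cmat_transpose of_real_1)+

lemma mat_mult_commute:
  fixes A :: "'a::comm_semiring_1^'n^'m"
  shows "A ** mat c = mat c ** A"
  by (simp add: vec_eq_iff mat_eq_diag mult.commute)

lemma mat_mult_mat: "mat c ** mat d = (mat (c * d) :: 'a::comm_semiring_1^'n^'n)"
  by (simp add: vec_eq_iff) (simp add: mat_def)

lemma moduli_action_action:
  "moduli_action u V (moduli_action u' V' \<Lambda>) = moduli_action (u * u') (V ** V') \<Lambda>"
proof -
  have "cmat V ** (mat (u'\<^sup>2) ** (cmat V' ** \<Lambda> ** transpose (cmat V'))) =
      mat (u'\<^sup>2) ** (cmat V ** (cmat V' ** \<Lambda> ** transpose (cmat V')))"
    by (metis mat_mult_commute matrix_mul_assoc)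
  then show ?thesis
    unfolding moduli_action_def
    by (simp add: cmat_mult matrix_transpose_mul matrix_mul_assoc power_mult_distrib
        flip: mat_mult_mat)
qed

lemma moduli_action_id: "moduli_action 1 (mat 1) \<Lambda> = \<Lambda>"
  by (simp add: moduli_action_def cmat_mat transpose_mat)

lemma rotation_matrix_mult: "rotation_matrix V \<Longrightarrow> rotation_matrix V' \<Longrightarrow> rotation_matrix (V ** V')"
  for V :: "real^'n^'n"
  by (simp add: rotation_matrix_def orthogonal_matrix_mul det_mul)

lemma rotation_matrix_transpose: "rotation_matrix V \<Longrightarrow> rotation_matrix (transpose V)"
  for V :: "real^'n^'n"
  by (simp add: rotation_matrix_def orthogonal_matrix_transpose det_transpose)

lemma moduli_rel_refl: "\<Lambda> \<in> symmetric_unitary \<Longrightarrow> (\<Lambda>, \<Lambda>) \<in> moduli_rel"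
  unfolding moduli_rel_def
  by (auto simp: moduli_action_id rotation_matrix_def orthogonal_matrix_id
      intro!: exI[of _ 1] exI[of _ "mat 1"])

lemma moduli_rel_sym:
  assumes "(\<Lambda>, \<Lambda>') \<in> moduli_rel"
  shows "(\<Lambda>', \<Lambda>) \<in> moduli_rel"
proof -
  obtain u V where *: "\<Lambda> \<in> symmetric_unitary" "\<Lambda>' \<in> symmetric_unitary" "norm u = 1"
    "rotation_matrix V" "\<Lambda>' = moduli_action u V \<Lambda>"
    using assms by (auto simp: moduli_rel_def)
  have "cnj u * u = 1" using *(3) by (metis complex_norm_square mult.commute of_real_1 one_power2)
  moreover have "transpose V ** V = mat 1"
    using *(4) by (simp add: rotation_matrix_def orthogonal_matrix_def)
  ultimately have "\<Lambda> = moduli_action (cnj u) (transpose V) \<Lambda>'"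
    by (simp add: *(5) moduli_action_action moduli_action_id)
  moreover have "norm (cnj u) = 1" "rotation_matrix (transpose V)"
    using * rotation_matrix_transpose by simp_all
  ultimately show ?thesis
    using *(1,2) unfolding moduli_rel_def by blast
qed

lemma moduli_rel_trans:
  assumes "(\<Lambda>, \<Lambda>') \<in> moduli_rel" "(\<Lambda>', \<Lambda>'') \<in> moduli_rel"
  shows "(\<Lambda>, \<Lambda>'') \<in> moduli_rel"
proof -
  obtain u V u' V' where *: "\<Lambda> \<in> symmetric_unitary" "\<Lambda>'' \<in> symmetric_unitary" "norm u = 1"
    "rotation_matrix V" "\<Lambda>' = moduli_action u V \<Lambda>" "norm u' = 1" "rotation_matrix V'"
    "\<Lambda>'' = moduli_action u' V' \<Lambda>'"
    using assms by (auto simp: moduli_rel_def)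
  then have "\<Lambda>'' = moduli_action (u' * u) (V' ** V) \<Lambda>" "norm (u' * u) = 1" "rotation_matrix (V' ** V)"
    by (simp_all add: moduli_action_action norm_mult rotation_matrix_mult)
  then show ?thesis using * unfolding moduli_rel_def by blast
qed

lemma equiv_moduli_rel: "equiv symmetric_unitary moduli_rel"
proof (rule equivI)
  show "moduli_rel \<subseteq> symmetric_unitary \<times> symmetric_unitary" by (auto simp: moduli_rel_def)
  show "refl_on symmetric_unitary moduli_rel"
    by (auto simp: refl_on_def moduli_rel_refl)
  show "sym moduli_rel" by (auto intro: symI moduli_rel_sym)
  show "trans moduli_rel" by (rule transI) (rule moduli_rel_trans)
qed

lemma diag_matrix_symmetric_unitary:
  assumes "\<And>i. norm (d i) = 1"
  shows "diag_matrix d \<in> symmetric_unitary"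
proof -
  have "d i * cnj (d i) = 1" for i
    using assms[of i] by (metis complex_norm_square of_real_1 one_power2)
  moreover have "transpose (map_matrix cnj (diag_matrix d)) = diag_matrix (\<lambda>i. cnj (d i))"
    by (simp add: vec_eq_iff)
  ultimately show ?thesis
    by (simp add: symmetric_unitary_def vec_eq_iff mat_def mult.commute)
qed

lemma diag_phi_symmetric_unitary: "diag_phi x \<in> symmetric_unitary"
  by (simp add: diag_phi_eq diag_matrix_symmetric_unitary)

text \<open>A diagonal matrix is fixed by the reflection changing the sign of the first basis vector,
  so orthogonal matrices may be used in place of rotations.\<close>

lemma moduli_rel_orthogonal_diag:
  assumes \<Lambda>: "\<Lambda> \<in> symmetric_unitary" and V: "orthogonal_matrix V" and u: "norm u = 1"
    and diag: "cmat V ** \<Lambda> ** transpose (cmat V) = diag_matrix \<mu>"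
    and \<Lambda>': "diag_matrix (\<lambda>i. u\<^sup>2 * \<mu> i) \<in> symmetric_unitary"
  shows "(\<Lambda>, diag_matrix (\<lambda>i. u\<^sup>2 * \<mu> i)) \<in> moduli_rel"
proof -
  \<comment> \<open>The sign is \<open>det V\<close> itself, so that \<open>J ** V\<close> has
    determinant \<open>(det V)^2 = 1\<close> whichever sign occurs.\<close>
  define J :: "real^4^4" where "J = diag_matrix (\<lambda>i. if i = 1 then det V else 1)"
  have detV: "det V = 1 \<or> det V = - 1" using det_orthogonal_matrix[OF V] .
  have J: "J ** J = mat 1" "transpose J = J"
    using detV by (auto simp: J_def vec_eq_iff mat_def)
  have "det J = (\<Prod>i\<in>UNIV. J $ i $ i)"
    by (rule det_diagonal) (simp add: J_def)
  also have "\<dots> = (\<Prod>i\<in>UNIV. if i = (1::4) then det V else 1)" by (simp add: J_def)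
  also have "\<dots> = det V" by (simp only: prod.delta finite UNIV_I if_True)
  finally have "det (J ** V) = 1" using detV by (auto simp: det_mul)
  moreover have "orthogonal_matrix (J ** V)"
    using V J by (intro orthogonal_matrix_mul) (simp_all add: orthogonal_matrix)
  ultimately have rot: "rotation_matrix (J ** V)" by (simp add: rotation_matrix_def)
  have "cmat (J ** V) ** \<Lambda> ** transpose (cmat (J ** V)) =
      cmat J ** (cmat V ** \<Lambda> ** transpose (cmat V)) ** cmat J"
    by (simp add: cmat_mult matrix_transpose_mul matrix_mul_assoc flip: cmat_transpose)
      (simp add: J(2))
  also have "\<dots> = diag_matrix \<mu>"
    using detV by (auto simp: diag J_def cmat_diag vec_eq_iff)
  finally have "diag_matrix (\<lambda>i. u\<^sup>2 * \<mu> i) = moduli_action u (J ** V) \<Lambda>"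
    by (simp add: moduli_action_def vec_eq_iff)
  then show ?thesis unfolding moduli_rel_def using \<Lambda> \<Lambda>' u rot by blast
qed

lemma cis_eq_iff_pi: "cis (- 2 * a) = cis (- 2 * b) \<longleftrightarrow> (\<exists>k::int. a = b + pi * of_int k)"
proof -
  have "cis (- 2 * a) = cis (- 2 * b) \<longleftrightarrow> (\<exists>n::int. - 2 * a = - 2 * b + 2 * pi * of_int n)"
    unfolding sin_cos_eq_iff[symmetric] by (auto simp only: complex_eq_iff cis.sel)
  also have "\<dots> \<longleftrightarrow> (\<exists>k::int. a = b + pi * of_int k)"
  proof
    assume "\<exists>n::int. - 2 * a = - 2 * b + 2 * pi * of_int n"
    then obtain k :: int where "- 2 * a = - 2 * b + 2 * pi * of_int k" by blast
    then have "a = b + pi * of_int (- k)" by simp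
    then show "\<exists>k::int. a = b + pi * of_int k" by blast
  next
    assume "\<exists>k::int. a = b + pi * of_int k"
    then obtain k :: int where "a = b + pi * of_int k" by blast
    then have "- 2 * a = - 2 * b + 2 * pi * of_int (- k)" by simp
    then show "\<exists>n::int. - 2 * a = - 2 * b + 2 * pi * of_int n" by blast
  qed
  finally show ?thesis .
qed

text \<open>The permutation matrix of \<open>\<sigma>\<close> relabels the eigenvalues and
  \<open>u = cis (- c)\<close> rotates them, as \<open>u\<close> acts by its square. An odd
  permutation has determinant \<open>-1\<close>, whence the passage through orthogonal
  matrices.\<close>

lemma config_equiv_imp_moduli_rel:
  assumes "config_equiv x y"
  shows "(diag_phi x, diag_phi y) \<in> moduli_rel"
proof -
  obtain \<sigma> c where \<sigma>: "\<sigma> permutes UNIV"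
    and k: "\<And>i. \<exists>k::int. lift y i = lift x (\<sigma> i) + c + pi * of_int k"
    using assms by (auto simp: config_equiv_def)
  define V :: "real^4^4" where "V = perm_matrix \<sigma>"
  have inj: "\<sigma> i = \<sigma> j \<longleftrightarrow> i = j" for i j
    using permutes_inj[OF \<sigma>] by (auto dest: injD)
  have "V ** transpose V = mat 1"
    unfolding V_def by (simp add: vec_eq_iff) (simp add: perm_matrix_def mat_def inj)
  then have V: "orthogonal_matrix V"
    using matrix_left_right_inverse unfolding orthogonal_matrix_def by blast
  have "cmat V ** diag_phi x ** transpose (cmat V) = diag_matrix (\<lambda>i. cis (- 2 * lift x (\<sigma> i)))"
    unfolding V_def cmat_perm by (simp add: vec_eq_iff diag_phi_eq inj del: mult_diag_nth)
  moreover have "diag_phi y = diag_matrix (\<lambda>i. (cis (- c))\<^sup>2 * cis (- 2 * lift x (\<sigma> i)))"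
  proof -
    have "cis (- 2 * lift y i) = cis (- 2 * (lift x (\<sigma> i) + c))" for i
      unfolding cis_eq_iff_pi using k by blast
    moreover have "(cis (- c))\<^sup>2 * cis (- 2 * lift x (\<sigma> i)) = cis (- 2 * (lift x (\<sigma> i) + c))" for i
      by (simp add: power2_eq_square cis_mult algebra_simps)
    ultimately show ?thesis by (simp add: diag_phi_eq)
  qed
  ultimately show ?thesis
    using moduli_rel_orthogonal_diag[OF diag_phi_symmetric_unitary V, of "cis (- c)"]
      diag_phi_symmetric_unitary[of y] by simp
qed

text \<open>A nonzero term in the expansion of the determinant of the intertwining matrix provides the
  permutation matching the two sets of eigenvalues.\<close>

lemma moduli_rel_imp_config_equiv:
  assumes "(diag_phi x, diag_phi y) \<in> moduli_rel"
  shows "config_equiv x y"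
proof -
  obtain u V where u: "norm u = 1" and V: "rotation_matrix V"
    and eq: "diag_phi y = moduli_action u V (diag_phi x)"
    using assms by (auto simp: moduli_rel_def)
  have VV: "transpose (cmat V) ** cmat V = mat 1"
    using V by (simp add: rotation_matrix_def cmat_orthogonal)
  have "diag_phi y ** cmat V = mat (u\<^sup>2) ** (cmat V ** diag_phi x ** (transpose (cmat V) ** cmat V))"
    unfolding eq moduli_action_def by (simp add: matrix_mul_assoc)
  then have "diag_phi y ** cmat V = mat (u\<^sup>2) ** (cmat V ** diag_phi x)"
    by (simp add: VV)
  \<comment> \<open>Every nonzero entry of \<open>V\<close> thus matches an eigenvalue of one matrix
    with a rotated eigenvalue of the other.\<close>
  then have entry: "cis (- 2 * lift y i) * of_real (V $ i $ j) =
      u\<^sup>2 * (of_real (V $ i $ j) * cis (- 2 * lift x j))" for i j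
    by (auto simp: vec_eq_iff diag_phi_eq)
  have "det V \<noteq> 0" using V by (simp add: rotation_matrix_def)
  then obtain \<sigma> where \<sigma>: "\<sigma> permutes UNIV" "of_int (sign \<sigma>) * (\<Prod>i\<in>UNIV. V $ i $ \<sigma> i) \<noteq> 0"
    unfolding det_def by (metis (mono_tags, lifting) mem_Collect_eq sum.neutral)
  then have nz: "V $ i $ \<sigma> i \<noteq> 0" for i by auto
  obtain a where a: "u = cis a" using u by (metis cis_Arg complex_norm_eq_1_exp cis_conv_exp)
  have "\<exists>k::int. lift y i = lift x (\<sigma> i) + (- a) + pi * of_int k" for i
  proof -
    have "cis (- 2 * lift y i) = u\<^sup>2 * cis (- 2 * lift x (\<sigma> i))"
      using entry[of i "\<sigma> i"] nz[of i] by (simp add: mult_ac)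
    also have "\<dots> = cis (- 2 * (lift x (\<sigma> i) + (- a)))"
      by (simp add: a power2_eq_square cis_mult algebra_simps)
    finally show ?thesis unfolding cis_eq_iff_pi .
  qed
  then show ?thesis unfolding config_equiv_def using \<sigma>(1) by blast
qed

lemma moduli_rel_diag_phi_iff: "(diag_phi x, diag_phi y) \<in> moduli_rel \<longleftrightarrow> config_equiv x y"
  using config_equiv_imp_moduli_rel moduli_rel_imp_config_equiv by blast

lemma symmetric_unitary_diagonalizable:
  assumes \<Lambda>: "\<Lambda> \<in> symmetric_unitary"
  shows "\<exists>x. (\<Lambda>, diag_phi x) \<in> moduli_rel"
proof -
  have symm: "\<Lambda> $ j $ i = \<Lambda> $ i $ j" for i j
    using \<Lambda> by (simp add: symmetric_unitary_def vec_eq_iff)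
  have unit: "(\<Sum>k\<in>UNIV. \<Lambda> $ i $ k * cnj (\<Lambda> $ k $ j)) = (if i = j then 1 else 0)" for i j
  proof -
    have "(\<Lambda> ** transpose (map_matrix cnj \<Lambda>)) $ i $ j = (mat 1 :: complex^4^4) $ i $ j"
      using \<Lambda> by (simp add: symmetric_unitary_def)
    then show ?thesis by (simp add: matrix_mult_nth mat_def symm)
  qed
  define X Y :: "real^4^4" where "X = map_matrix Re \<Lambda>" and "Y = map_matrix Im \<Lambda>"
  have XY: "transpose X = X" "transpose Y = Y"
    by (simp_all add: X_def Y_def vec_eq_iff symm)
  \<comment> \<open>For symmetric \<Lambda>, unitarity reads (X + iY)(X - iY) = 1. The imaginary
    part is this commutation; the real part, X^2 + Y^2 = 1, later puts the eigenvalues on the unit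
    circle.\<close>
  have "X ** Y = Y ** X"
  proof -
    have "(Y ** X) $ i $ j - (X ** Y) $ i $ j = Im (\<Sum>k\<in>UNIV. \<Lambda> $ i $ k * cnj (\<Lambda> $ k $ j))" for i j
      by (simp add: X_def Y_def matrix_mult_nth sum_subtractf)
    then have "(Y ** X) $ i $ j - (X ** Y) $ i $ j = 0" for i j
      by (simp only: unit) simp
    then show ?thesis by (simp add: vec_eq_iff)
  qed
  then obtain V d e where V: "orthogonal_matrix V"
    and d: "\<And>i. X *v (V $ i) = d i *\<^sub>R V $ i" and e: "\<And>i. Y *v (V $ i) = e i *\<^sub>R V $ i"
    using commuting_symmetric_eigenbasis[OF XY] by metis
  define \<mu> where "\<mu> i = Complex (d i) (e i)" for i
  have eigen: "(\<Lambda> ** transpose (cmat V)) $ i $ j = transpose (cmat V) $ i $ j * \<mu> j" for i j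
  proof -
    have "(X *v (V $ j)) $ i = d j * V $ j $ i" "(Y *v (V $ j)) $ i = e j * V $ j $ i"
      by (simp_all add: d e)
    then show ?thesis
      by (simp add: complex_eq_iff matrix_mult_nth matrix_vector_mult_def X_def Y_def \<mu>_def mult.commute)
  qed
  then have "\<Lambda> ** transpose (cmat V) = transpose (cmat V) ** diag_matrix \<mu>"
    by (simp add: vec_eq_iff)
  then have diag: "cmat V ** \<Lambda> ** transpose (cmat V) = diag_matrix \<mu>"
    by (metis cmat_orthogonal(1)[OF V] matrix_mul_assoc matrix_mul_lid)
  have norm_\<mu>: "norm (\<mu> i) = 1" for i
  proof -
    have "(X ** X) $ k $ l + (Y ** Y) $ k $ l = Re (\<Sum>m\<in>UNIV. \<Lambda> $ k $ m * cnj (\<Lambda> $ m $ l))" for k l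
      by (simp add: X_def Y_def matrix_mult_nth sum.distrib)
    then have "X ** X + Y ** Y = mat 1" by (simp add: vec_eq_iff unit mat_def)
    then have "X *v (X *v (V $ i)) + Y *v (Y *v (V $ i)) = V $ i"
      by (simp add: matrix_vector_mul_assoc flip: matrix_vector_mult_add_rdistrib)
    then have "((d i)\<^sup>2 + (e i)\<^sup>2) *\<^sub>R V $ i = 1 *\<^sub>R V $ i"
      by (simp add: d e matrix_vector_mult_scaleR power2_eq_square scaleR_add_left)
    moreover have "V $ i \<noteq> 0"
    proof
      assume "V $ i = 0"
      then have "(V ** transpose V) $ i $ i = 0" by (simp add: matrix_mult_nth)
      then show False using V by (simp add: orthogonal_matrix_def mat_def)
    qed
    ultimately have "(d i)\<^sup>2 + (e i)\<^sup>2 = 1" by (simp only: scaleR_cancel_right) simp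
    then show ?thesis by (simp add: \<mu>_def cmod_def)
  qed
  define \<theta> where "\<theta> i = - Arg (\<mu> i) / 2" for i
  have \<theta>: "\<mu> i = cis (- 2 * \<theta> i)" for i
  proof -
    have "\<mu> i \<noteq> 0" using norm_\<mu>[of i] by auto
    then have "cis (Arg (\<mu> i)) = \<mu> i" using cis_Arg norm_\<mu>[of i] by (simp add: sgn_eq)
    then show ?thesis by (simp add: \<theta>_def)
  qed
  \<comment> \<open>The scalar \<open>cis (\<theta> 1)\<close>, acting by its square, normalizes the
    first eigenvalue to \<open>1\<close>.\<close>
  define x :: "real^3" where "x = vector [\<theta> 2 - \<theta> 1, \<theta> 3 - \<theta> 1, \<theta> 4 - \<theta> 1]"
  have lift: "lift x i = \<theta> i - \<theta> 1" for i
    by (cases i rule: index_4_cases) (simp_all add: x_def)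
  have "cis (- 2 * lift x i) = (cis (\<theta> 1))\<^sup>2 * \<mu> i" for i
    unfolding lift by (simp add: \<theta> power2_eq_square cis_mult algebra_simps)
  then have "diag_phi x = diag_matrix (\<lambda>i. (cis (\<theta> 1))\<^sup>2 * \<mu> i)"
    by (simp only: diag_phi_eq)
  then have "(\<Lambda>, diag_phi x) \<in> moduli_rel"
    using moduli_rel_orthogonal_diag[OF \<Lambda> V _ diag, of "cis (\<theta> 1)"] diag_phi_symmetric_unitary[of x]
    by simp
  then show ?thesis by blast
qed

section \<open>The gluing\<close>

text \<open>Every pairing comes from \<gamma> or from \<open>W\<close>, so chains of pairings stay
  within one class. Conversely two equivalent points of the polyhedron differ by at most one
  pairing, namely \<gamma> on its face in one of the two directions.\<close>

lemma gluing_rel_eq: "gluing_rel = {(x, y). x \<in> domain_AB \<and> y \<in> domain_AB \<and> config_equiv x y}"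
proof -
  have pairing: "config_equiv x y" if "face_pairing x y" for x y
    using that unfolding face_pairing_def
  proof (elim disjE conjE bexE exE)
    show "config_equiv x y" if "y = gamma_map x"
      using that by (simp add: config_equiv_gamma_map)
    show "config_equiv x y" if "wall_reflection F s" "y = s x" for F s
      using that config_equiv_weyl by (auto simp: wall_reflection_def W_eq)
  qed
  have "config_equiv x y" if "equivclp face_pairing x y" for x y
    using that
  proof (induction rule: equivclp_induct)
    case base
    show ?case by (rule config_equiv_refl)
  next
    case (step y z)
    then show ?case using pairing config_equiv_sym config_equiv_trans by blast
  qed
  moreover have "equivclp face_pairing x y"
    if x: "x \<in> domain_AB" and y: "y \<in> domain_AB" and "config_equiv x y" for x y
    using domain_AB_fiber[OF that]
  proof (elim disjE)
    assume "y = x"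
    then show ?thesis by simp
  next
    assume "x $ 1 = x $ 3 + pi / 2 \<and> y = gamma_map x"
    then have "face_pairing x y" using x by (auto simp: face_pairing_def face_P'QZ_eq)
    then show ?thesis by (rule r_into_equivclp)
  next
    assume "y $ 1 = y $ 3 + pi / 2 \<and> x = gamma_map y"
    then have "face_pairing y x" using y by (auto simp: face_pairing_def face_P'QZ_eq)
    then show ?thesis by (intro equivclp_sym[OF r_into_equivclp])
  qed
  ultimately show ?thesis unfolding gluing_rel_def by blast
qed

lemma equiv_gluing_rel: "equiv domain_AB gluing_rel"
proof (rule equivI)
  show "gluing_rel \<subseteq> domain_AB \<times> domain_AB" by (auto simp: gluing_rel_eq)
  show "refl_on domain_AB gluing_rel"
    by (auto simp: refl_on_def gluing_rel_eq config_equiv_refl)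
  show "sym gluing_rel" by (auto intro!: symI simp: gluing_rel_eq config_equiv_sym)
  show "trans gluing_rel"
    by (rule transI) (auto simp: gluing_rel_eq intro: config_equiv_trans)
qed

lemma homeomorphic_map_quotient_topology:
  assumes R: "equiv (topspace X) R" and S: "equiv (topspace Y) S"
    and f: "continuous_map X Y f"
    and iff: "\<And>x x'. x \<in> topspace X \<Longrightarrow> x' \<in> topspace X \<Longrightarrow> (f x, f x') \<in> S \<longleftrightarrow> (x, x') \<in> R"
    and surj: "\<And>y. y \<in> topspace Y \<Longrightarrow> \<exists>x\<in>topspace X. (f x, y) \<in> S"
    and closed: "\<And>C. closedin X C \<Longrightarrow> closedin Y (S `` (f ` C))"
  shows "\<exists>h. homeomorphic_map (quotient_topology X R) (quotient_topology Y S) h \<and>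
    (\<forall>x\<in>topspace X. h (R `` {x}) = S `` {f x})"
proof -
  define p where "p = (\<lambda>x. R `` {x})"
  define q where "q = (\<lambda>y. S `` {y})"
  have p: "quotient_map X (quotient_topology X R) p"
    unfolding p_def by (rule quotient_map_quotient_topology)
  have q: "quotient_map Y (quotient_topology Y S) q"
    unfolding q_def by (rule quotient_map_quotient_topology)
  have fY: "f x \<in> topspace Y" if "x \<in> topspace X" for x
    using f that by (auto simp: continuous_map_def)
  have p_eq: "p x = p x' \<longleftrightarrow> (x, x') \<in> R" if "x \<in> topspace X" "x' \<in> topspace X" for x x'
    unfolding p_def using eq_equiv_class_iff[OF R that] .
  have q_eq: "q y = q y' \<longleftrightarrow> (y, y') \<in> S" if "y \<in> topspace Y" "y' \<in> topspace Y" for y y'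
    unfolding q_def using eq_equiv_class_iff[OF S that] .
  have fibers: "(q \<circ> f) x = (q \<circ> f) x' \<longleftrightarrow> p x = p x'"
    if "x \<in> topspace X" "x' \<in> topspace X" for x x'
    using that by (simp add: p_eq q_eq fY iff)
  have g: "quotient_map X (quotient_topology Y S) (q \<circ> f)"
  proof (rule continuous_closed_imp_quotient_map)
    show "continuous_map X (quotient_topology Y S) (q \<circ> f)"
      using continuous_map_compose[OF f quotient_imp_continuous_map[OF q]] .
    show "closed_map X (quotient_topology Y S) (q \<circ> f)"
      unfolding closed_map_def
    proof (intro allI impI)
      fix C assume C: "closedin X C"
      have CX: "C \<subseteq> topspace X" using C by (rule closedin_subset)
      have sub: "(q \<circ> f) ` C \<subseteq> topspace (quotient_topology Y S)"
        using fY CX by (auto simp: topspace_quotient_topology quotient_def q_def)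
      have "{y \<in> topspace Y. q y \<in> (q \<circ> f) ` C} = S `` (f ` C)"
      proof (intro Set.set_eqI iffI)
        fix y assume "y \<in> {y \<in> topspace Y. q y \<in> (q \<circ> f) ` C}"
        then obtain x where "y \<in> topspace Y" "x \<in> C" "q (f x) = q y" by auto
        then have "(f x, y) \<in> S" using q_eq fY CX by blast
        then show "y \<in> S `` (f ` C)" using \<open>x \<in> C\<close> by blast
      next
        fix y assume "y \<in> S `` (f ` C)"
        then obtain x where x: "x \<in> C" "(f x, y) \<in> S" by blast
        then have y: "y \<in> topspace Y" using S by (auto simp: equiv_def refl_on_def)
        then have "q (f x) = q y" using q_eq fY CX x by blast
        then show "y \<in> {y \<in> topspace Y. q y \<in> (q \<circ> f) ` C}" using x y by force
      qed
      then have "closedin Y {y \<in> topspace Y. q y \<in> (q \<circ> f) ` C}" using closed[OF C] by simp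
      then show "closedin (quotient_topology Y S) ((q \<circ> f) ` C)"
        using q sub unfolding quotient_map_closedin by blast
    qed
    show "(q \<circ> f) ` topspace X = topspace (quotient_topology Y S)"
    proof
      show "(q \<circ> f) ` topspace X \<subseteq> topspace (quotient_topology Y S)"
        using fY by (auto simp: topspace_quotient_topology quotient_def q_def)
      show "topspace (quotient_topology Y S) \<subseteq> (q \<circ> f) ` topspace X"
      proof
        fix c assume "c \<in> topspace (quotient_topology Y S)"
        then obtain y where y: "y \<in> topspace Y" "c = q y"
          by (auto simp: topspace_quotient_topology quotient_def q_def)
        obtain x where x: "x \<in> topspace X" "(f x, y) \<in> S" using surj[OF y(1)] by blast
        then have "q (f x) = q y" using q_eq fY y(1) by blast
        then have "c = (q \<circ> f) x" using y(2) by simp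
        then show "c \<in> (q \<circ> f) ` topspace X" using x(1) by blast
      qed
    qed
  qed
  obtain h where h: "continuous_map (quotient_topology X R) (quotient_topology Y S) h"
    "\<And>x. x \<in> topspace X \<Longrightarrow> h (p x) = (q \<circ> f) x"
    using quotient_map_lift_exists[OF p quotient_imp_continuous_map[OF g]] fibers by metis
  obtain k where k: "continuous_map (quotient_topology Y S) (quotient_topology X R) k"
    "\<And>x. x \<in> topspace X \<Longrightarrow> k ((q \<circ> f) x) = p x"
    using quotient_map_lift_exists[OF g quotient_imp_continuous_map[OF p]] fibers by metis
  have "homeomorphic_maps (quotient_topology X R) (quotient_topology Y S) h k"
    unfolding homeomorphic_maps_def
    using h k quotient_imp_surjective_map[OF p] quotient_imp_surjective_map[OF g]
    by (metis imageE)
  then have "homeomorphic_map (quotient_topology X R) (quotient_topology Y S) h"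
    by (rule homeomorphic_maps_imp_map)
  then show ?thesis using h(2) by (auto simp: p_def q_def)
qed

section \<open>Compactness of the group and closed saturations\<close>

lemma compact_rotation_matrices: "compact {V :: real^'n^'n. rotation_matrix V}"
proof -
  have "{V :: real^'n^'n. rotation_matrix V} =
      {V. \<forall>i j. (\<Sum>k\<in>UNIV. V $ i $ k * V $ j $ k) = (if i = j then 1 else 0)} \<inter> {V. det V = 1}"
  proof -
    have "orthogonal_matrix V \<longleftrightarrow> V ** transpose V = mat 1" for V :: "real^'n^'n"
      using matrix_left_right_inverse unfolding orthogonal_matrix_def by blast
    then show ?thesis
      by (simp add: rotation_matrix_def vec_eq_iff matrix_mult_nth mat_def Collect_conj_eq)
  qed
  also have "closed \<dots>"
    unfolding det_def
    by (intro closed_Int closed_Collect_all closed_Collect_eq continuous_intros)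
  finally have "closed {V :: real^'n^'n. rotation_matrix V}" .
  moreover have "bounded {V :: real^'n^'n. rotation_matrix V}"
    unfolding bounded_iff
  proof (intro exI ballI)
    fix V :: "real^'n^'n" assume "V \<in> {V. rotation_matrix V}"
    then have row: "norm (V $ i) = 1" for i
      by (simp add: rotation_matrix_def orthogonal_matrix_orthonormal_rows row_def vec_lambda_eta)
    have "norm V \<le> (\<Sum>i\<in>UNIV. norm (V $ i))"
      unfolding norm_vec_def[of V] by (intro L2_set_le_sum) simp
    then show "norm V \<le> real CARD('n)" by (simp add: row)
  qed
  ultimately show ?thesis by (simp add: compact_eq_bounded_closed)
qed

lemma continuous_on_lift [continuous_intros]:
  "continuous_on S f \<Longrightarrow> continuous_on S (\<lambda>x. lift (f x) i)"
  by (cases i rule: index_4_cases) (auto intro!: continuous_intros)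

lemma continuous_on_diag_phi: "continuous_on S diag_phi"
  unfolding diag_phi_eq[abs_def] diag_matrix_def
proof (intro continuous_on_vec_lambda)
  fix i j
  show "continuous_on S (\<lambda>x. if i = j then cis (- 2 * lift x i) else 0)"
    by (cases "i = j") (auto intro!: continuous_intros)
qed

lemma moduli_action_diag_phi_nth:
  "moduli_action u V (diag_phi x) $ i $ j =
    u\<^sup>2 * (\<Sum>k\<in>UNIV. of_real (V $ i $ k) * cis (- 2 * lift x k) * of_real (V $ j $ k))"
  by (simp add: moduli_action_def diag_phi_eq matrix_mult_nth[of "cmat V ** _"])

text \<open>The saturation consists of the symmetric unitary members of \<open>K\<close>, the
  continuous image of a product of three compact sets. Intersecting with
  \<open>symmetric_unitary\<close> avoids proving that the action preserves it.\<close>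

lemma closedin_moduli_saturation:
  assumes "compact C"
  shows "closedin (top_of_set symmetric_unitary) (moduli_rel `` (diag_phi ` C))"
proof -
  define act where "act = (\<lambda>(u, V, x). moduli_action u V (diag_phi x))"
  define K where "K = act ` (sphere 0 1 \<times> {V. rotation_matrix V} \<times> C)"
  have "act = (\<lambda>z. \<chi> i j. (fst z)\<^sup>2 * (\<Sum>k\<in>UNIV. of_real (fst (snd z) $ i $ k) *
      cis (- 2 * lift (snd (snd z)) k) * of_real (fst (snd z) $ j $ k)))"
    by (simp add: act_def fun_eq_iff vec_eq_iff moduli_action_diag_phi_nth)
  then have "continuous_on S act" for S
    by (simp only:) (intro continuous_intros)
  then have "compact K"
    unfolding K_def using assms
    by (intro compact_continuous_image compact_Times compact_sphere compact_rotation_matrices)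
  moreover have "moduli_rel `` (diag_phi ` C) = symmetric_unitary \<inter> K"
  proof
    show "moduli_rel `` (diag_phi ` C) \<subseteq> symmetric_unitary \<inter> K"
      by (force simp: moduli_rel_def K_def act_def)
    show "symmetric_unitary \<inter> K \<subseteq> moduli_rel `` (diag_phi ` C)"
      using diag_phi_symmetric_unitary by (fastforce simp: moduli_rel_def K_def act_def)
  qed
  ultimately show ?thesis by (simp add: closedin_closed_Int compact_imp_closed)
qed

lemma glued_space_homeomorphic_moduli_space:
  "\<exists>h. homeomorphic_map glued_space moduli_space h \<and>
    (\<forall>x\<in>domain_AB. h (gluing_rel `` {x}) = moduli_rel `` {diag_phi x})"
proof -
  have "\<exists>h. homeomorphic_map (quotient_topology (top_of_set domain_AB) gluing_rel)
      (quotient_topology (top_of_set symmetric_unitary) moduli_rel) h \<and>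
    (\<forall>x\<in>topspace (top_of_set domain_AB). h (gluing_rel `` {x}) = moduli_rel `` {diag_phi x})"
  proof (rule homeomorphic_map_quotient_topology)
    show "equiv (topspace (top_of_set domain_AB)) gluing_rel" by (simp add: equiv_gluing_rel)
    show "equiv (topspace (top_of_set symmetric_unitary)) moduli_rel"
      by (simp add: equiv_moduli_rel)
    show "continuous_map (top_of_set domain_AB) (top_of_set symmetric_unitary) diag_phi"
      using diag_phi_symmetric_unitary by (auto simp: continuous_on_diag_phi)
    show "(diag_phi x, diag_phi x') \<in> moduli_rel \<longleftrightarrow> (x, x') \<in> gluing_rel"
      if "x \<in> topspace (top_of_set domain_AB)" "x' \<in> topspace (top_of_set domain_AB)" for x x'
      using that by (simp add: moduli_rel_diag_phi_iff gluing_rel_eq)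
    show "\<exists>x\<in>topspace (top_of_set domain_AB). (diag_phi x, \<Lambda>) \<in> moduli_rel"
      if \<Lambda>: "\<Lambda> \<in> topspace (top_of_set symmetric_unitary)" for \<Lambda>
    proof -
      obtain x where x: "(\<Lambda>, diag_phi x) \<in> moduli_rel"
        using symmetric_unitary_diagonalizable \<Lambda> by auto
      obtain y where y: "y \<in> domain_AB" "config_equiv x y"
        using config_equiv_domain_AB by blast
      have "(\<Lambda>, diag_phi y) \<in> moduli_rel"
        using x y(2) moduli_rel_diag_phi_iff moduli_rel_trans by blast
      then show ?thesis using y(1) moduli_rel_sym by auto
    qed
    show "closedin (top_of_set symmetric_unitary) (moduli_rel `` (diag_phi ` C))"
      if "closedin (top_of_set domain_AB) C" for C
      using that compact_domain_AB closedin_compact by (intro closedin_moduli_saturation) blast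
  qed
  then show ?thesis by (simp add: glued_space_def moduli_space_def)
qed

theorem proposition3p7:
  shows
    "(3 simplex simplex_A \<and> 3 simplex simplex_B \<and>
      inj_on torus_proj (simplex_A \<union> simplex_B) \<and>
      fundamental_domain torus W (\<lambda>w c. w ` c) (torus_proj ` (simplex_A \<union> simplex_B)))
     \<and>
     (gamma_map \<in> Gamma_W \<and>
      gamma_map pt_P' = pt_Z \<and> gamma_map pt_Q = pt_P \<and> gamma_map pt_Z = pt_P' \<and>
      gamma_map ` face_P'QZ = face_ZPP' \<and>
      face_P'QZ \<noteq> face_ZPP' \<and> face_P'QZ \<notin> walls \<and> face_ZPP' \<notin> walls \<and>
      {F. F facet_of domain_AB} = {face_P'QZ, face_ZPP'} \<union> walls \<and>
      (\<forall>F\<in>walls. (\<exists>!s. wall_reflection F s) \<and>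
         (\<forall>s. wall_reflection F s \<longrightarrow> s ` domain_AB \<inter> domain_AB = F)) \<and>
      (\<exists>h. homeomorphic_map glued_space moduli_space h \<and>
         (\<forall>x\<in>domain_AB. h (gluing_rel `` {x}) = moduli_rel `` {diag_phi x})))"
proof (intro conjI ballI)
  show "inj_on torus_proj (simplex_A \<union> simplex_B)"
    using inj_on_torus_proj by (simp add: domain_AB_def)
  show "fundamental_domain torus W (\<lambda>w c. w ` c) (torus_proj ` (simplex_A \<union> simplex_B))"
    using fundamental_domain_AB by (simp add: domain_AB_def)
  fix F assume "F \<in> walls"
  note refl = walls_reflection[OF this]
  show "\<exists>!s. wall_reflection F s" using refl by blast
  show "\<forall>s. wall_reflection F s \<longrightarrow> s ` domain_AB \<inter> domain_AB = F" using refl by blast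
qed (fact simplex_A simplex_B gamma_map_in_Gamma_W gamma_map_pts gamma_map_face faces_neq
    faces_notin_walls facets_eq glued_space_homeomorphic_moduli_space)+

end
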